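(* Let $n\ge 2$ and let $\mathbf a=(a_1,\dots,a_n)\in\mathbb Z^n$ with $a_i\ge 1$ for each $i$. Then the $f$-polynomial $f_{\mathscr A(P_{\mathbf a})}(z)$ of the poset associahedron of the complete graded poset $P_{\mathbf a}$ is invariant under permutation of $\mathbf a$; that is, for every permutation $\pi$ of $\{1,\dots,n\}$ and $\mathbf a'=(a_{\pi(1)},\dots,a_{\pi(n)})$, one has $f_{\mathscr A(P_{\mathbf a})}(z)=f_{\mathscr A(P_{\mathbf a'})}(z)$.
   Context: For $\mathbf a=(a_1,\dots,a_n)\in\mathbb Z^n$ with all $a_i\ge1$, the complete graded poset of type $\mathbf a$ is $P_{\mathbf a}=\{x_{ij} : 1\le i\le n,\ 1\le j\le a_i\}$, with $x_{ij}\prec x_{i'j'}$ if and only if $i<i'$ (an ordinal sum of antichains). Let $P$ be a finite connected poset (its Hasse diagram is a connected graph) with at least two elements. A proper tube of $P$ is a subset $\tau \subsetneq P$ such that: $|\tau|\ge 2$; $\tau$ is convex, i.e. for all $x,z\in\tau$ and $y\in P$, $x\preceq y\preceq z$ implies $y\in\tau$; and $\tau$ is connected as an induced subgraph of the Hasse diagram of $P$. A proper tubing of $P$ is a collection $T$ of proper tubes such that (i) any two tubes $\sigma,\tau\in T$ are nested or disjoint ($\sigma\subseteq\tau$, $\tau\subseteq\sigma$, or $\sigma\cap\tau=\emptyset$), and (ii) the directed graph $D_T$ with vertex set $T$, having an edge $(\sigma,\tau)$ whenever $\sigma\cap\tau=\emptyset$ and there exist $x\in\sigma$, $y\in\tau$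 with $x\prec y$, is acyclic. The empty collection is a proper tubing. The poset associahedron $\mathscr A(P)$ is the simple polytope of dimension $|P|-2$ (unique up to combinatorial equivalence; its existence is a theorem of Galashin) whose poset of nonempty faces is isomorphic to the set of proper tubings of $P$ ordered by reverse inclusion. The face corresponding to a proper tubing $T$ has codimension $|T|$. The $f$-polynomial of a $d$-dimensional polytope $R$ is $f_R(z)=\sum_{i=0}^d f_i z^i$, where $f_i$ is the number of $i$-dimensional faces of $R$. Thus for $\mathscr A(P)$, $f_i$ is the number of proper tubings of $P$ consisting of exactly $|P|-2-i$ tubes. *)

theory Defs
  imports
    "HOL-Analysis.Analysis"
    "HOL-Computational_Algebra.Polynomial"
    "HOL-Combinatorics.Permutations"
begin

(* A poset is represented by its reflexive order relation r (Partial_order r);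
   the ground set is Field r, and x is below y iff (x, y) \<in> r. *)

definition covers :: "'v rel \<Rightarrow> 'v rel" where
  "covers r = {(x, y). (x, y) \<in> r \<and> x \<noteq> y \<and>
     \<not> (\<exists>z. (x, z) \<in> r \<and> (z, y) \<in> r \<and> z \<noteq> x \<and> z \<noteq> y)}"

definition hasse_edges :: "'v rel \<Rightarrow> 'v rel" where
  "hasse_edges r = covers r \<union> (covers r)\<inverse>"

definition hasse_connected :: "'v rel \<Rightarrow> 'v set \<Rightarrow> bool" where
  "hasse_connected r S \<longleftrightarrow> (\<forall>x\<in>S. \<forall>y\<in>S. (x, y) \<in> (hasse_edges r \<inter> S \<times> S)\<^sup>*)"

definition finite_connected_poset :: "'v rel \<Rightarrow> bool" where
  "finite_connected_poset r \<longleftrightarrow>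
     Partial_order r \<and> finite (Field r) \<and> 2 \<le> card (Field r) \<and> hasse_connected r (Field r)"

definition order_convex :: "'v rel \<Rightarrow> 'v set \<Rightarrow> bool" where
  "order_convex r S \<longleftrightarrow>
     (\<forall>x\<in>S. \<forall>z\<in>S. \<forall>y\<in>Field r. (x, y) \<in> r \<and> (y, z) \<in> r \<longrightarrow> y \<in> S)"

definition proper_tube :: "'v rel \<Rightarrow> 'v set \<Rightarrow> bool" where
  "proper_tube r \<tau> \<longleftrightarrow>
     \<tau> \<subset> Field r \<and> 2 \<le> card \<tau> \<and> order_convex r \<tau> \<and> hasse_connected r \<tau>"

definition tubing_digraph :: "'v rel \<Rightarrow> 'v set set \<Rightarrow> 'v set rel" where
  "tubing_digraph r T = {(\<sigma>, \<tau>). \<sigma> \<in> T \<and> \<tau> \<in> T \<and> \<sigma> \<inter> \<tau> = {} \<and>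
     (\<exists>x\<in>\<sigma>. \<exists>y\<in>\<tau>. (x, y) \<in> r \<and> x \<noteq> y)}"

definition proper_tubing :: "'v rel \<Rightarrow> 'v set set \<Rightarrow> bool" where
  "proper_tubing r T \<longleftrightarrow>
     (\<forall>\<tau>\<in>T. proper_tube r \<tau>) \<and>
     (\<forall>\<sigma>\<in>T. \<forall>\<tau>\<in>T. \<sigma> \<subseteq> \<tau> \<or> \<tau> \<subseteq> \<sigma> \<or> \<sigma> \<inter> \<tau> = {}) \<and>
     acyclic (tubing_digraph r T)"

(* facet_of excludes the empty face, so a point (dimension 0) has no facets and is simple. *)
definition simple_polytope :: "'a::euclidean_space set \<Rightarrow> bool" where
  "simple_polytope R \<longleftrightarrow> polytope R \<and> R \<noteq> {} \<and>
     (\<forall>v. v extreme_point_of R \<longrightarrow> int (card {F. F facet_of R \<and> v \<in> F}) = aff_dim R)"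

(* The poset associahedron is only defined up to combinatorial equivalence, so it is
   a predicate on polytopes: R is a realization of the poset associahedron of r. *)
definition poset_associahedron :: "'v rel \<Rightarrow> 'a::euclidean_space set \<Rightarrow> bool" where
  "poset_associahedron r R \<longleftrightarrow>
     finite_connected_poset r \<and> simple_polytope R \<and>
     aff_dim R = int (card (Field r)) - 2 \<and>
     (\<exists>\<phi>. bij_betw \<phi> {F. F face_of R \<and> F \<noteq> {}} {T. proper_tubing r T} \<and>
        (\<forall>F G. F face_of R \<and> F \<noteq> {} \<and> G face_of R \<and> G \<noteq> {} \<longrightarrow>
           (F \<subseteq> G \<longleftrightarrow> \<phi> G \<subseteq> \<phi> F)))"

definition f_polynomial :: "'a::euclidean_space set \<Rightarrow> int poly" where
  "f_polynomial R =
     (\<Sum>i\<le>nat (aff_dim R). monom (int (card {F. F face_of R \<and> aff_dim F = int i})) i)"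

(* The f-polynomial of the poset associahedron of r read off from the tubings, a face
   of dimension i being a proper tubing with |P| - 2 - i tubes; unlike f_polynomial,
   this does not refer to a realization. *)
definition tubing_f_polynomial :: "'v rel \<Rightarrow> int poly" where
  "tubing_f_polynomial r =
     (\<Sum>i\<le>card (Field r) - 2.
        monom (int (card {T. proper_tubing r T \<and> card T = card (Field r) - 2 - i})) i)"

(* The element x_ij is the pair (i, j). Only the values a 1, ..., a n matter. *)
definition complete_graded_set :: "nat \<Rightarrow> (nat \<Rightarrow> nat) \<Rightarrow> (nat \<times> nat) set" where
  "complete_graded_set n a = {(i, j). 1 \<le> i \<and> i \<le> n \<and> 1 \<le> j \<and> j \<le> a i}"

definition complete_graded_poset :: "nat \<Rightarrow> (nat \<Rightarrow> nat) \<Rightarrow> (nat \<times> nat) rel" where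
  "complete_graded_poset n a = {(x, y). x \<in> complete_graded_set n a \<and>
     y \<in> complete_graded_set n a \<and> (x = y \<or> fst x < fst y)}"

lemma Field_complete_graded_poset: "Field (complete_graded_poset n a) = complete_graded_set n a"
  by (auto simp: Field_def complete_graded_poset_def)

lemma Partial_order_complete_graded_poset: "Partial_order (complete_graded_poset n a)"
  unfolding Field_complete_graded_poset partial_order_on_def preorder_on_def
  by (auto simp: complete_graded_poset_def refl_on_def trans_def antisym_def)

lemma finite_complete_graded_set: "finite (complete_graded_set n a)"
proof -
  have "complete_graded_set n a = (SIGMA i:{1..n}. {1..a i})"
    by (auto simp: complete_graded_set_def)
  then show ?thesis by simp
qed

lemma finite_connected_complete_graded_poset:
  assumes n: "2 \<le> n" and a: "\<forall>i\<in>{1..n}. 1 \<le> a i"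
  shows "finite_connected_poset (complete_graded_poset n a)"
proof -
  let ?S = "complete_graded_set n a" and ?r = "complete_graded_poset n a"
  let ?E = "hasse_edges ?r \<inter> ?S \<times> ?S"
  have edge: "((i, j), (Suc i, k)) \<in> ?E \<and> ((Suc i, k), (i, j)) \<in> ?E"
    if "(i, j) \<in> ?S" "(Suc i, k) \<in> ?S" for i j k
    using that by (auto simp: hasse_edges_def covers_def complete_graded_poset_def)
  have mem: "(i, 1) \<in> ?S" if "1 \<le> i" "i \<le> n" for i
    using that a by (auto simp: complete_graded_set_def)
  have sym: "sym (?E\<^sup>*)"
    by (intro sym_rtrancl) (auto simp: sym_def hasse_edges_def)
  have base: "((1, 1), (i, 1)) \<in> ?E\<^sup>*" if "1 \<le> i" "i \<le> n" for i
    using that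
  proof (induction i rule: dec_induct)
    case base then show ?case by simp
  next
    case (step m)
    then have "((m, 1), (Suc m, 1)) \<in> ?E"
      using edge[of m 1 1] mem[of m] mem[of "Suc m"] by simp
    with step show ?case by (meson Suc_leD rtrancl.rtrancl_into_rtrancl)
  qed
  have reach: "((1, 1), (i, j)) \<in> ?E\<^sup>*" if ij: "(i, j) \<in> ?S" for i j
  proof (cases "i = n")
    case True
    then obtain m where m: "i = Suc m" "1 \<le> m" using n by (cases i) auto
    then have "((m, 1), (i, j)) \<in> ?E" using edge[of m 1 j] mem[of m] ij True by simp
    with base[of m] m True show ?thesis by (meson Suc_leD order_refl rtrancl.rtrancl_into_rtrancl)
  next
    case False
    then have "1 \<le> i" "Suc i \<le> n" using ij by (auto simp: complete_graded_set_def)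
    then have "((Suc i, 1), (i, j)) \<in> ?E" using edge[of i j 1] mem[of "Suc i"] ij by simp
    moreover have "((1, 1), (Suc i, 1)) \<in> ?E\<^sup>*" using base[of "Suc i"] \<open>Suc i \<le> n\<close> by simp
    ultimately show ?thesis by (rule rtrancl.rtrancl_into_rtrancl[rotated])
  qed
  have conn: "hasse_connected ?r ?S"
    unfolding hasse_connected_def
  proof (intro ballI)
    fix x y assume "x \<in> ?S" "y \<in> ?S"
    then have "((1, 1), x) \<in> ?E\<^sup>*" "((1, 1), y) \<in> ?E\<^sup>*"
      using reach[of "fst x" "snd x"] reach[of "fst y" "snd y"] by auto
    then show "(x, y) \<in> ?E\<^sup>*" using sym by (meson rtrancl_trans symD)
  qed
  have "{(1, 1), (2, 1)} \<subseteq> ?S" using mem[of 1] mem[of 2] n by simp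
  then have "card {(1, 1), (2::nat, 1::nat)} \<le> card ?S"
    by (meson card_mono finite_complete_graded_set)
  then have "2 \<le> card ?S" by simp
  with conn show ?thesis
    unfolding finite_connected_poset_def
    using Partial_order_complete_graded_poset[of n a]
    by (simp add: Field_complete_graded_poset finite_complete_graded_set)
qed

end

theory Submission
  imports Defs "HOL-Computational_Algebra.Formal_Power_Series"
begin

text \<open>
  The generating function of tubings depends on the poset only through data that are insensitive to
  reversing the order inside an interval of consecutive levels. Since the transposition of two levels
  is a composition of two such reversals, and transpositions generate all permutations, the claim
  follows (\<open>tubing_sum_interval_reversal\<close>, \<open>tubing_sum_permute_levels\<close>).

  To see the invariance, let \<open>W\<close>, \<open>S\<close>, \<open>U\<close> be levelled sets, stacked in this order, and let \<open>g\<close> denote the sum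
  of \<open>t\<close> to the number of tubes over all tubings, where the whole poset is allowed as a tube. A tube
  that contains a part of \<open>S\<close> and elements of \<open>U\<close> but none of \<open>W\<close> meets \<open>S\<close> in an upset, and one that
  contains a part of \<open>S\<close> and elements of \<open>W\<close> but none of \<open>U\<close> meets \<open>S\<close> in a downset disjoint from it.
  All such tubes together cut \<open>S\<close> into a sequence of consecutive blocks, nonempty except possibly for
  the one between the downsets and the upsets, and what remains to be chosen inside \<open>S\<close> is a tubing
  of each block. Hence \<open>g\<close> of the whole is a linear combination of the chain sums of \<open>S\<close>,
  where the \<open>k\<close>-th chain sum runs over all ways to cut \<open>S\<close> by a chain of upsets into \<open>k\<close> nonempty
  blocks, weighted by the product of \<open>g\<close> over the blocks, and the coefficients depend only on \<open>W\<close>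
  and \<open>U\<close> (\<open>expands_sandwich\<close>). A tubing of the dual of a block is a tubing of the block, so reversing
  the order of \<open>S\<close> just reverses the sequence of blocks and preserves every chain sum
  (\<open>chain_sum_dual\<close>).

  The expansion is proved by induction from a recursion for \<open>g\<close> that splits off the largest tube that
  meets the top level (\<open>tubing_sum_recursion\<close>). In algebraic terms, chain sums are powers with respect
  to a convolution over upsets, and the expansion says that \<open>g\<close> of the stack is a formal power series
  evaluated in this algebra; this form makes the recursion easy to solve.

  Finally, the proper tubings of a complete graded poset are the tubings of the levelled set
  that omit the whole set (\<open>proper_tubing_iff\<close>), and the dimensions of the faces of any realization
  are read off from the numbers of tubes (\<open>f_polynomial_eq_tubing_f_polynomial\<close>).
\<close>

section \<open>Tubings of levelled sets\<close>

text \<open>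
  A poset that is an ordinal sum of antichains is given by a finite set \<open>V\<close> and a level function \<open>l\<close>:
  distinct elements are comparable exactly when their levels differ, and empty levels are
  harmless. Taking integer levels makes the dual poset the one with levels \<open>- l\<close>. In such a
  poset a convex set with at least two elements is connected exactly when it meets two levels,
  which is the form that the definition uses. In contrast to proper tubes, \<open>V\<close> itself may be a
  tube; this makes the recursion below uniform.
\<close>

definition tube :: "('v \<Rightarrow> int) \<Rightarrow> 'v set \<Rightarrow> 'v set \<Rightarrow> bool" where
  "tube l V M \<longleftrightarrow> M \<subseteq> V \<and> (\<exists>x\<in>M. \<exists>y\<in>M. l x < l y) \<and>
     (\<forall>x\<in>M. \<forall>y\<in>V. \<forall>z\<in>M. l x < l y \<and> l y < l z \<longrightarrow> y \<in> M)"

text \<open>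
  Two disjoint tubes form no 2-cycle in the tubing digraph exactly when one of them lies weakly
  below the other; they may share one boundary level.
\<close>

definition before :: "('v \<Rightarrow> int) \<Rightarrow> 'v set \<Rightarrow> 'v set \<Rightarrow> bool" where
  "before l A B \<longleftrightarrow> A \<inter> B = {} \<and> (\<forall>x\<in>A. \<forall>y\<in>B. l x \<le> l y)"

definition compatible :: "('v \<Rightarrow> int) \<Rightarrow> 'v set \<Rightarrow> 'v set \<Rightarrow> bool" where
  "compatible l A B \<longleftrightarrow> A \<subseteq> B \<or> B \<subseteq> A \<or> before l A B \<or> before l B A"

definition tubings :: "('v \<Rightarrow> int) \<Rightarrow> 'v set \<Rightarrow> 'v set set set" where
  "tubings l V = {T. (\<forall>A\<in>T. tube l V A) \<and> (\<forall>A\<in>T. \<forall>B\<in>T. compatible l A B)}"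

text \<open>
  The indeterminate of the generating polynomial is replaced by a real number \<open>t\<close>. Letting \<open>t\<close> range
  over the positive reals loses no information, and the division by \<open>1 + t\<close> is then possible.
\<close>

definition tubing_sum :: "real \<Rightarrow> ('v \<Rightarrow> int) \<Rightarrow> 'v set \<Rightarrow> real" where
  "tubing_sum t l V = (\<Sum>T\<in>tubings l V. t ^ card T)"

definition rooted_sum :: "real \<Rightarrow> ('v \<Rightarrow> int) \<Rightarrow> 'v set \<Rightarrow> real" where
  "rooted_sum t l V = (\<Sum>T\<in>{T \<in> tubings l V. V \<in> T}. t ^ card T)"

definition proper_sum :: "real \<Rightarrow> ('v \<Rightarrow> int) \<Rightarrow> 'v set \<Rightarrow> real" where
  "proper_sum t l V = (\<Sum>T\<in>{T \<in> tubings l V. V \<notin> T}. t ^ card T)"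

lemma tubings_subset: "tubings l V \<subseteq> Pow (Pow V)"
  by (auto simp: tubings_def tube_def)

lemma tubing_subset: "T \<in> tubings l V \<Longrightarrow> A \<in> T \<Longrightarrow> A \<subseteq> V"
  and tubing_nonempty: "T \<in> tubings l V \<Longrightarrow> A \<in> T \<Longrightarrow> A \<noteq> {}"
  by (auto simp: tubings_def tube_def)

lemma finite_tubings: "finite V \<Longrightarrow> finite (tubings l V)"
  by (rule finite_subset[OF tubings_subset]) simp

lemma finite_tubing: "finite V \<Longrightarrow> T \<in> tubings l V \<Longrightarrow> finite T"
  using tubings_subset[of l V] by (meson PowD finite_Pow_iff finite_subset subsetD)

text \<open>
  Only the comparisons between levels matter, and the notion of a tubing is self-dual. Self-duality
  is the source of the symmetry that is proved in this theory.
\<close>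

lemma tubings_cong:
  assumes "\<And>x y. x \<in> V \<Longrightarrow> y \<in> V \<Longrightarrow> l x < l y \<longleftrightarrow> l' x < l' y"
  shows "tubings l V = tubings l' V"
proof -
  have t: "tube l V A = tube l' V A" for A
  proof (cases "A \<subseteq> V")
    case True
    show ?thesis unfolding tube_def using assms True by (smt (verit) subsetD)
  qed (auto simp: tube_def)
  have b: "before l A B = before l' A B" if "A \<subseteq> V" "B \<subseteq> V" for A B
    unfolding before_def using assms that by (meson linorder_not_less subsetD)
  have c: "compatible l A B = compatible l' A B" if "A \<subseteq> V" "B \<subseteq> V" for A B
    unfolding compatible_def using b[OF that] b[OF that(2,1)] by blast
  have sub: "A \<subseteq> V" if "tube l' V A" for A using that by (simp add: tube_def)
  show ?thesis
    unfolding tubings_def t using c sub by blast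
qed

lemma tubings_dual:
  assumes "\<And>x y. x \<in> V \<Longrightarrow> y \<in> V \<Longrightarrow> l x < l y \<longleftrightarrow> l' y < l' x"
  shows "tubings l V = tubings l' V"
proof -
  have t: "tube l V A = tube l' V A" for A
  proof (cases "A \<subseteq> V")
    case True
    show ?thesis unfolding tube_def using assms True by (smt (verit) subsetD)
  qed (auto simp: tube_def)
  have b: "before l A B = before l' B A" if "A \<subseteq> V" "B \<subseteq> V" for A B
    unfolding before_def using assms that by (metis linorder_not_less subsetD inf_commute)
  have c: "compatible l A B = compatible l' A B" if "A \<subseteq> V" "B \<subseteq> V" for A B
    unfolding compatible_def using b[OF that] b[OF that(2,1)] by blast
  have sub: "A \<subseteq> V" if "tube l' V A" for A using that by (simp add: tube_def)
  show ?thesis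
    unfolding tubings_def t using c sub by blast
qed

lemma tubings_image:
  assumes "inj_on h V"
  shows "tubings l (h ` V) = (image (image h)) ` tubings (l \<circ> h) V"
proof -
  have t: "tube l (h ` V) (h ` A) \<longleftrightarrow> tube (l \<circ> h) V A" if "A \<subseteq> V" for A
  proof -
    have "h y \<in> h ` A \<longleftrightarrow> y \<in> A" if "y \<in> V" for y
      using that \<open>A \<subseteq> V\<close> assms by (meson inj_on_image_mem_iff)
    then have "(\<forall>x\<in>h ` A. \<forall>y\<in>h ` V. \<forall>z\<in>h ` A. l x < l y \<and> l y < l z \<longrightarrow> y \<in> h ` A) \<longleftrightarrow>
        (\<forall>x\<in>A. \<forall>y\<in>V. \<forall>z\<in>A. l (h x) < l (h y) \<and> l (h y) < l (h z) \<longrightarrow> y \<in> A)"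
      unfolding ball_simps by blast
    moreover have "h ` A \<subseteq> h ` V" using that by (rule image_mono)
    ultimately show ?thesis unfolding tube_def bex_simps o_def using that by blast
  qed
  have b: "before l (h ` A) (h ` B) \<longleftrightarrow> before (l \<circ> h) A B" if "A \<subseteq> V" "B \<subseteq> V" for A B
    unfolding before_def inj_on_image_Int[OF assms that, symmetric] image_is_empty ball_simps o_def ..
  have c: "compatible l (h ` A) (h ` B) \<longleftrightarrow> compatible (l \<circ> h) A B" if "A \<subseteq> V" "B \<subseteq> V" for A B
    unfolding compatible_def using that b inj_on_image_subset_iff[OF assms] by auto
  have iff: "image h ` T \<in> tubings l (h ` V) \<longleftrightarrow> T \<in> tubings (l \<circ> h) V" if "T \<subseteq> Pow V" for T
    using that t c unfolding tubings_def by (auto simp: subset_iff)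
  have ex: "\<exists>T\<subseteq>Pow V. T' = image h ` T" if "T' \<in> tubings l (h ` V)" for T'
  proof -
    have "T' \<subseteq> image h ` Pow V"
      using that tubings_subset[of l "h ` V"] by (simp add: subset_iff image_Pow_surj)
    then show ?thesis by (auto elim: subset_imageE)
  qed
  show ?thesis
  proof (intro subset_antisym subsetI)
    fix T' assume T': "T' \<in> tubings l (h ` V)"
    then obtain T where T: "T \<subseteq> Pow V" "T' = image h ` T" using ex by blast
    then have "T \<in> tubings (l \<circ> h) V" using T' iff by simp
    then show "T' \<in> image (image h) ` tubings (l \<circ> h) V" using T by (rule_tac image_eqI)
  next
    fix T' assume "T' \<in> image (image h) ` tubings (l \<circ> h) V"
    then obtain T where T: "T \<in> tubings (l \<circ> h) V" "T' = image h ` T" by (rule imageE)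
    then have "T \<subseteq> Pow V" using tubings_subset by blast
    then show "T' \<in> tubings l (h ` V)" using T iff by simp
  qed
qed

lemma tubing_sum_image:
  assumes "inj_on h V"
  shows "tubing_sum t l (h ` V) = tubing_sum t (l \<circ> h) V"
proof -
  have i: "inj_on (image h) (Pow V)" by (rule inj_on_image_Pow[OF assms])
  then have ii: "inj_on (image (image h)) (tubings (l \<circ> h) V)"
    by (meson inj_on_image_Pow inj_on_subset tubings_subset)
  have "card (image h ` T) = card T" if "T \<in> tubings (l \<circ> h) V" for T
    using i that tubings_subset[of "l \<circ> h" V] by (meson PowD card_image in_mono inj_on_subset)
  then show ?thesis
    unfolding tubing_sum_def tubings_image[OF assms] sum.reindex[OF ii] by simp
qed

lemma tubing_sum_cong:
  assumes "\<And>x y. x \<in> V \<Longrightarrow> y \<in> V \<Longrightarrow> l x < l y \<longleftrightarrow> l' x < l' y"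
  shows "tubing_sum t l V = tubing_sum t l' V"
  unfolding tubing_sum_def using tubings_cong[of V l l'] assms by simp

lemma tubing_sum_dual:
  assumes "\<And>x y. x \<in> V \<Longrightarrow> y \<in> V \<Longrightarrow> l x < l y \<longleftrightarrow> l' y < l' x"
  shows "tubing_sum t l V = tubing_sum t l' V"
  unfolding tubing_sum_def using tubings_dual[of V l l'] assms by simp

lemma tubing_sum_empty: "tubing_sum t l {} = 1"
proof -
  have "tubings l {} = {{}}" by (auto simp: tubings_def tube_def)
  then show ?thesis by (simp add: tubing_sum_def)
qed

text \<open>
  A set with two levels is a tube of itself that is compatible with all its tubes, so it may be
  added to or removed from any tubing.
\<close>

lemma rooted_sum_proper_sum:
  assumes "finite V" "x \<in> V" "y \<in> V" "l x < l y"
  shows "rooted_sum t l V = t * proper_sum t l V"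
proof -
  let ?P = "{T \<in> tubings l V. V \<notin> T}" and ?R = "{T \<in> tubings l V. V \<in> T}"
  have V: "tube l V V" using assms by (auto simp: tube_def)
  have ins: "insert V T \<in> tubings l V" if "T \<in> tubings l V" for T
  proof -
    have "A \<subseteq> V" if "A \<in> insert V T" for A
      using that \<open>T \<in> tubings l V\<close> tubings_subset by blast
    then have "compatible l A B" if "A \<in> insert V T" "B \<in> insert V T" for A B
      using that \<open>T \<in> tubings l V\<close> unfolding tubings_def compatible_def by (cases "A = V \<or> B = V") blast+
    then show ?thesis using that V by (simp add: tubings_def)
  qed
  have del: "T - {V} \<in> tubings l V" if "T \<in> tubings l V" for T
    using that by (auto simp: tubings_def)
  have "bij_betw (insert V) ?P ?R"
    by (rule bij_betw_byWitness[where f' = "\<lambda>T. T - {V}"]) (auto intro: ins del)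
  then have "rooted_sum t l V = (\<Sum>T\<in>?P. t ^ card (insert V T))"
    unfolding rooted_sum_def by (rule sum.reindex_bij_betw[symmetric])
  also have "\<dots> = (\<Sum>T\<in>?P. t * t ^ card T)"
    by (rule sum.cong) (auto simp: finite_tubing[OF assms(1)])
  finally show ?thesis by (simp add: proper_sum_def sum_distrib_left)
qed

lemma tubing_sum_split: 
  assumes "finite V"
  shows "tubing_sum t l V = proper_sum t l V + rooted_sum t l V"
proof -
  have "tubings l V = {T \<in> tubings l V. V \<notin> T} \<union> {T \<in> tubings l V. V \<in> T}" by auto
  then show ?thesis
    unfolding tubing_sum_def proper_sum_def rooted_sum_def
    by (subst sum.union_disjoint[symmetric]) (auto simp: finite_tubings[OF assms])
qed

lemma tubing_sum_proper_sum:
  assumes "finite V" "x \<in> V" "y \<in> V" "l x < l y"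
  shows "tubing_sum t l V = (1 + t) * proper_sum t l V"
  using tubing_sum_split[OF assms(1)] rooted_sum_proper_sum[OF assms] by (simp add: algebra_simps)

section \<open>The recursion on the largest tube that meets the top level\<close>

definition upsets :: "('v \<Rightarrow> int) \<Rightarrow> 'v set \<Rightarrow> 'v set set" where
  "upsets l V = {K. K \<subseteq> V \<and> (\<forall>x\<in>K. \<forall>y\<in>V. l x < l y \<longrightarrow> y \<in> K)}"

lemma finite_upsets: "finite V \<Longrightarrow> finite (upsets l V)"
  by (rule finite_subset[of _ "Pow V"]) (auto simp: upsets_def)

text \<open>
  A tube that meets the top level \<open>N\<close> consists of an arbitrary nonempty part of \<open>N\<close> and a
  nonempty upset of the rest: by convexity, everything between its elements and \<open>N\<close> belongs to it.
\<close>

lemma bij_betw_top_tubes: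
  assumes sep: "\<And>x y. x \<in> V \<Longrightarrow> y \<in> N \<Longrightarrow> l x < l y" and N: "\<And>x y. x \<in> N \<Longrightarrow> y \<in> N \<Longrightarrow> l x = l y"
  shows "bij_betw (\<lambda>(B, K). K \<union> B) ((Pow N - {{}}) \<times> (upsets l V - {{}}))
           {M. tube l (V \<union> N) M \<and> M \<inter> N \<noteq> {}}"
proof -
  have disj: "V \<inter> N = {}" using sep by blast
  show ?thesis
  proof (rule bij_betw_byWitness[where f' = "\<lambda>M. (M \<inter> N, M - N)"], goal_cases)
    case 1
    then show ?case using disj by (auto simp: upsets_def)
  next
    case 2
    then show ?case by auto
  next
    case 3
    have "tube l (V \<union> N) (K \<union> B)" if "B \<subseteq> N" "B \<noteq> {}" "K \<in> upsets l V" "K \<noteq> {}" for B K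
      unfolding tube_def
    proof (intro conjI ballI impI)
      show "K \<union> B \<subseteq> V \<union> N" using that by (auto simp: upsets_def)
      obtain x y where "x \<in> K" "y \<in> B" using \<open>K \<noteq> {}\<close> \<open>B \<noteq> {}\<close> by blast
      moreover have "x \<in> V" "y \<in> N"
        using that calculation unfolding upsets_def by blast+
      ultimately show "\<exists>x\<in>K \<union> B. \<exists>y\<in>K \<union> B. l x < l y"
        using sep[of x y] by blast
    next
      fix x y z assume *: "x \<in> K \<union> B" "y \<in> V \<union> N" "z \<in> K \<union> B" "l x < l y \<and> l y < l z"
      have "z \<in> V \<union> N" "x \<in> V \<union> N" using * that by (auto simp: upsets_def)
      then have "y \<in> V" using * sep N by (metis UnE order.asym order.irrefl)
      moreover have "x \<in> K"
        using * that \<open>y \<in> V\<close> sep by (metis UnE order.asym subsetD)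
      ultimately show "y \<in> K \<union> B" using * that by (auto simp: upsets_def)
    qed
    then show ?case by auto
  next
    case 4
    have "M \<inter> N \<in> Pow N - {{}} \<and> M - N \<in> upsets l V - {{}}"
      if M: "tube l (V \<union> N) M" "M \<inter> N \<noteq> {}" for M
    proof -
      obtain n where n: "n \<in> M" "n \<in> N" using M by auto
      obtain x y where xy: "x \<in> M" "y \<in> M" "l x < l y" using M by (auto simp: tube_def)
      have "x \<notin> N" using xy M N sep by (metis UnE order.asym order.irrefl subsetD tube_def)
      moreover have "M - N \<in> upsets l V"
        using M n sep disj unfolding upsets_def tube_def by blast
      ultimately show ?thesis using M xy by auto
    qed
    then show ?case by auto
  qed
qed


text \<open>
  Throughout, \<open>N\<close> is the top level and \<open>V\<close> is the rest. Tubes that meet \<open>N\<close> are pairwise nested, so a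
  tubing with such tubes has a largest one, \<open>M\<close>. All other tubes lie inside \<open>M\<close> or, outside, in the
  downset \<open>V - M\<close>, and the two parts can be chosen independently.
\<close>

context
  fixes l :: "'v \<Rightarrow> int" and V N :: "'v set"
  assumes sep: "\<And>x y. x \<in> V \<Longrightarrow> y \<in> N \<Longrightarrow> l x < l y"
    and N: "\<And>x y. x \<in> N \<Longrightarrow> y \<in> N \<Longrightarrow> l x = l y"
begin

text \<open>
  A tube that lies weakly above an element of \<open>N\<close> is contained in the single level \<open>N\<close>, which is
  impossible.
\<close>

lemma top_tube_not_before:
  assumes "A \<inter> N \<noteq> {}" "tube l (V \<union> N) B"
  shows "\<not> before l A B"
proof
  assume b: "before l A B"
  obtain n where n: "n \<in> A" "n \<in> N" using assms(1) by blast
  have BN: "B \<subseteq> N"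
  proof
    fix y assume y: "y \<in> B"
    then have "l n \<le> l y" using b n unfolding before_def by blast
    moreover have "y \<in> V \<union> N" using y assms(2) unfolding tube_def by blast
    ultimately show "y \<in> N" using sep[of y n] n by auto
  qed
  obtain x y where "x \<in> B" "y \<in> B" "l x < l y" using assms(2) unfolding tube_def by blast
  then show False using BN N[of x y] by auto
qed

lemma tube_below_top: "tube l (V \<union> N) A \<and> A \<inter> N = {} \<longleftrightarrow> tube l V A"
proof -
  have "V \<inter> N = {}" using sep by blast
  moreover have "\<not> l y < l z" if "y \<in> N" "z \<in> V" for y z using sep[OF that(2,1)] by simp
  ultimately show ?thesis unfolding tube_def by blast
qed

lemma tube_in_top_tube:
  assumes M: "tube l (V \<union> N) M" "M \<inter> N \<noteq> {}"
  shows "tube l M A \<longleftrightarrow> tube l (V \<union> N) A \<and> A \<subseteq> M"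
  using M unfolding tube_def by blast

lemma below_complement:
  assumes M: "tube l (V \<union> N) M" "M \<inter> N \<noteq> {}" and x: "x \<in> V - M" and y: "y \<in> M"
  shows "l x \<le> l y"
proof (rule ccontr)
  assume "\<not> l x \<le> l y"
  moreover obtain n where "n \<in> M" "n \<in> N" using M by blast
  ultimately show False
    using M(1) x y sep[of x n] unfolding tube_def by (metis DiffE UnCI linorder_not_less)
qed

lemma tube_complement:
  assumes M: "tube l (V \<union> N) M" "M \<inter> N \<noteq> {}"
  shows "tube l (V - M) A \<longleftrightarrow> tube l (V \<union> N) A \<and> A \<subseteq> V - M"
proof -
  have "y \<in> V - M" if "y \<in> V \<union> N" "z \<in> V - M" "l y < l z" for y z
    using that below_complement[OF M, of z y] sep[of z y] by auto
  then show ?thesis unfolding tube_def by blast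
qed

lemma tubings_join:
  assumes M: "tube l (V \<union> N) M" "M \<inter> N \<noteq> {}"
    and T1: "T1 \<in> tubings l M" and T2: "T2 \<in> tubings l (V - M)"
  shows "T1 \<union> T2 \<in> tubings l (V \<union> N)"
proof -
  have "before l B A" if "A \<in> T1" "B \<in> T2" for A B
  proof -
    have "A \<subseteq> M" "B \<subseteq> V - M" using tubing_subset[OF T1] tubing_subset[OF T2] that by blast+
    then show ?thesis using below_complement[OF M] unfolding before_def by blast
  qed
  then have "compatible l A B" if "A \<in> T1 \<union> T2" "B \<in> T1 \<union> T2" for A B
    using that T1 T2 unfolding tubings_def compatible_def by blast
  moreover have "tube l (V \<union> N) A" if "A \<in> T1 \<union> T2" for A
    using that T1 T2 tube_in_top_tube[OF M] tube_complement[OF M] unfolding tubings_def by blast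
  ultimately show ?thesis unfolding tubings_def by blast
qed

lemma largest_top_tube:
  assumes fin: "finite (V \<union> N)" and T: "T \<in> tubings l (V \<union> N)" and "\<exists>A\<in>T. A \<inter> N \<noteq> {}"
  obtains M where "M \<in> T" "M \<inter> N \<noteq> {}" "\<And>A. A \<in> T \<Longrightarrow> A \<subseteq> M \<or> A \<subseteq> V - M"
proof -
  have "finite {A \<in> T. A \<inter> N \<noteq> {}}" using finite_tubing[OF fin T] by simp
  then obtain M where M: "M \<in> T" "M \<inter> N \<noteq> {}"
    and max: "\<And>A. A \<in> T \<Longrightarrow> A \<inter> N \<noteq> {} \<Longrightarrow> M \<subseteq> A \<Longrightarrow> A = M"
    using finite_has_maximal[of "{A \<in> T. A \<inter> N \<noteq> {}}"] assms(3) by blast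
  have "A \<subseteq> M \<or> A \<subseteq> V - M" if A: "A \<in> T" for A
  proof (rule ccontr)
    assume n: "\<not> (A \<subseteq> M \<or> A \<subseteq> V - M)"
    have tA: "tube l (V \<union> N) A" and tM: "tube l (V \<union> N) M" using A M T by (auto simp: tubings_def)
    have "compatible l A M" using A M T unfolding tubings_def by blast
    moreover have "\<not> M \<subseteq> A" using n max[OF A] M by blast
    moreover have "\<not> before l M A" by (rule top_tube_not_before[OF M(2) tA])
    ultimately have b: "before l A M" using n unfolding compatible_def by blast
    then have "A \<inter> N = {}" using top_tube_not_before[OF _ tM] by blast
    moreover have "A \<subseteq> V \<union> N" using tA by (simp add: tube_def)
    ultimately show False using b n unfolding before_def by blast
  qed
  then show thesis using M that by blast
qed

lemma tubings_restrict:
  assumes M: "tube l (V \<union> N) M" "M \<inter> N \<noteq> {}" and T: "T \<in> tubings l (V \<union> N)"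
  shows "{A \<in> T. A \<subseteq> M} \<in> tubings l M" "{A \<in> T. A \<subseteq> V - M} \<in> tubings l (V - M)"
  using T unfolding tubings_def tube_in_top_tube[OF M] tube_complement[OF M] by blast+

lemma bij_betw_top_split:
  assumes fin: "finite (V \<union> N)"
  shows "bij_betw (\<lambda>(M, T1, T2). T1 \<union> T2)
    (SIGMA M:{M. tube l (V \<union> N) M \<and> M \<inter> N \<noteq> {}}. {T \<in> tubings l M. M \<in> T} \<times> tubings l (V - M))
    {T \<in> tubings l (V \<union> N). \<exists>A\<in>T. A \<inter> N \<noteq> {}}"
proof -
  \<comment> \<open>The largest tube that meets the top level is the union of all such tubes.\<close>
  let ?M = "\<lambda>T. \<Union>{A \<in> T. A \<inter> N \<noteq> {}}"
  have disj: "V \<inter> N = {}" using sep by blast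
  show ?thesis
  proof (rule bij_betw_byWitness[where
        f' = "\<lambda>T. (?M T, {A \<in> T. A \<subseteq> ?M T}, {A \<in> T. A \<subseteq> V - ?M T})"], goal_cases)
    case 1
    have "?M (T1 \<union> T2) = M \<and> {A \<in> T1 \<union> T2. A \<subseteq> M} = T1 \<and> {A \<in> T1 \<union> T2. A \<subseteq> V - M} = T2"
      if M: "tube l (V \<union> N) M" "M \<inter> N \<noteq> {}" and T1: "T1 \<in> tubings l M" "M \<in> T1"
        and T2: "T2 \<in> tubings l (V - M)" for M T1 T2
    proof -
      have 1: "A \<subseteq> M \<and> A \<noteq> {}" if "A \<in> T1" for A
        using tubing_subset[OF T1(1) that] tubing_nonempty[OF T1(1) that] by blast
      have 2: "A \<subseteq> V - M \<and> A \<noteq> {}" if "A \<in> T2" for A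
        using tubing_subset[OF T2 that] tubing_nonempty[OF T2 that] by blast
      have "?M (T1 \<union> T2) \<subseteq> M" using 1 2 disj by blast
      moreover have "M \<subseteq> ?M (T1 \<union> T2)" using T1 M by blast
      moreover have "\<not> A \<subseteq> V - M" if "A \<in> T1" for A using 1[OF that] by blast
      moreover have "\<not> A \<subseteq> M" if "A \<in> T2" for A using 2[OF that] by blast
      moreover have "{A \<in> T1 \<union> T2. A \<subseteq> M} = T1" "{A \<in> T1 \<union> T2. A \<subseteq> V - M} = T2"
        using 1 2 calculation(3,4) by auto
      ultimately show ?thesis by (metis subset_antisym)
    qed
    note key = this
    show ?case
    proof (intro ballI)
      fix z assume z: "z \<in> (SIGMA M:{M. tube l (V \<union> N) M \<and> M \<inter> N \<noteq> {}}.
        {T \<in> tubings l M. M \<in> T} \<times> tubings l (V - M))"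
      obtain M T1 T2 where zz: "z = (M, T1, T2)" by (cases z) auto
      have e: "?M (T1 \<union> T2) = M" "{A \<in> T1 \<union> T2. A \<subseteq> M} = T1" "{A \<in> T1 \<union> T2. A \<subseteq> V - M} = T2"
        using key[of M T1 T2] z by (simp_all add: zz)
      show "(?M (case z of (M, T1, T2) \<Rightarrow> T1 \<union> T2), {A \<in> case z of (M, T1, T2) \<Rightarrow> T1 \<union> T2.
          A \<subseteq> ?M (case z of (M, T1, T2) \<Rightarrow> T1 \<union> T2)}, {A \<in> case z of (M, T1, T2) \<Rightarrow> T1 \<union> T2.
          A \<subseteq> V - ?M (case z of (M, T1, T2) \<Rightarrow> T1 \<union> T2)}) = z"
        by (simp only: zz prod.case e)
    qed
  next
    case 2
    have "{A \<in> T. A \<subseteq> ?M T} \<union> {A \<in> T. A \<subseteq> V - ?M T} = T"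
      if T: "T \<in> tubings l (V \<union> N)" "\<exists>A\<in>T. A \<inter> N \<noteq> {}" for T
    proof -
      obtain M where M: "M \<in> T" "M \<inter> N \<noteq> {}" "\<And>A. A \<in> T \<Longrightarrow> A \<subseteq> M \<or> A \<subseteq> V - M"
        using largest_top_tube[OF fin T] by blast
      then have eq: "?M T = M" using disj by blast
      show ?thesis unfolding eq using M(3) by blast
    qed
    then show ?case by auto
  next
    case 3
    show ?case
    proof (rule image_subsetI)
      fix z assume z: "z \<in> (SIGMA M:{M. tube l (V \<union> N) M \<and> M \<inter> N \<noteq> {}}.
        {T \<in> tubings l M. M \<in> T} \<times> tubings l (V - M))"
      obtain M T1 T2 where zz: "z = (M, T1, T2)" by (cases z) auto
      have "tube l (V \<union> N) M" "M \<inter> N \<noteq> {}" "T1 \<in> tubings l M" "M \<in> T1" "T2 \<in> tubings l (V - M)"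
        using z by (simp_all add: zz)
      then show "(case z of (M, T1, T2) \<Rightarrow> T1 \<union> T2) \<in> {T \<in> tubings l (V \<union> N). \<exists>A\<in>T. A \<inter> N \<noteq> {}}"
        using tubings_join[of M T1 T2] by (auto simp: zz)
    qed
  next
    case 4
    have "tube l (V \<union> N) (?M T) \<and> ?M T \<inter> N \<noteq> {} \<and> {A \<in> T. A \<subseteq> ?M T} \<in> tubings l (?M T) \<and> ?M T \<in> T \<and>
        {A \<in> T. A \<subseteq> V - ?M T} \<in> tubings l (V - ?M T)"
      if T: "T \<in> tubings l (V \<union> N)" "\<exists>A\<in>T. A \<inter> N \<noteq> {}" for T
    proof -
      obtain M where M: "M \<in> T" "M \<inter> N \<noteq> {}" "\<And>A. A \<in> T \<Longrightarrow> A \<subseteq> M \<or> A \<subseteq> V - M"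
        using largest_top_tube[OF fin T] by blast
      then have eq: "?M T = M" using disj by blast
      have t: "tube l (V \<union> N) M" using M T by (simp add: tubings_def)
      show ?thesis unfolding eq using tubings_restrict[OF t M(2) T(1)] t M by blast
    qed
    then show ?case by auto
  qed
qed

lemma tubing_sum_top_tube:
  assumes fin: "finite (V \<union> N)"
  shows "tubing_sum t l (V \<union> N) = tubing_sum t l V +
    (\<Sum>M\<in>{M. tube l (V \<union> N) M \<and> M \<inter> N \<noteq> {}}. rooted_sum t l M * tubing_sum t l (V - M))"
proof -
  let ?I = "{M. tube l (V \<union> N) M \<and> M \<inter> N \<noteq> {}}"
  let ?R = "\<lambda>M. {T \<in> tubings l M. M \<in> T}"
  let ?A = "{T \<in> tubings l (V \<union> N). \<forall>A\<in>T. A \<inter> N = {}}"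
  let ?B = "{T \<in> tubings l (V \<union> N). \<exists>A\<in>T. A \<inter> N \<noteq> {}}"
  have finI: "finite ?I"
    by (rule finite_subset[of _ "Pow (V \<union> N)"]) (use fin in \<open>auto simp: tube_def\<close>)
  have finM: "finite M" if "M \<in> ?I" for M
    using that fin by (auto simp: tube_def intro: finite_subset)
  have finT: "finite (tubings l (V \<union> N))" by (rule finite_tubings[OF fin])
  have "tubings l (V \<union> N) = ?A \<union> ?B" "?A \<inter> ?B = {}" by blast+
  then have "tubing_sum t l (V \<union> N) = (\<Sum>T\<in>?A. t ^ card T) + (\<Sum>T\<in>?B. t ^ card T)"
    unfolding tubing_sum_def[of t l "V \<union> N"] by (metis (no_types, lifting) finT finite_Un sum.union_disjoint)
  moreover have "?A = tubings l V"
    unfolding tubings_def tube_below_top[symmetric] by blast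
  moreover have "(\<Sum>T\<in>?B. t ^ card T) =
      (\<Sum>(M, T1, T2)\<in>(SIGMA M:?I. ?R M \<times> tubings l (V - M)). t ^ card (T1 \<union> T2))"
    using sum.reindex_bij_betw[OF bij_betw_top_split[OF fin], of "\<lambda>T. t ^ card T"]
    by (simp add: split_beta)
  moreover have "\<dots> = (\<Sum>M\<in>?I. \<Sum>(T1, T2)\<in>?R M \<times> tubings l (V - M). t ^ card (T1 \<union> T2))"
  proof (rule sum.Sigma[symmetric, OF finI], rule ballI)
    fix M assume "M \<in> ?I"
    then have "finite (tubings l M)" using finM finite_tubings by blast
    moreover have "finite (tubings l (V - M))" using fin by (intro finite_tubings) simp
    ultimately show "finite (?R M \<times> tubings l (V - M))" by simp
  qed
  moreover have "\<dots> = (\<Sum>M\<in>?I. rooted_sum t l M * tubing_sum t l (V - M))"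
  proof (rule sum.cong[OF refl])
    fix M assume M: "M \<in> ?I"
    have card: "card (T1 \<union> T2) = card T1 + card T2"
      if "T1 \<in> ?R M" "T2 \<in> tubings l (V - M)" for T1 T2
    proof (rule card_Un_disjoint)
      show "finite T1" using that finite_tubing[of M T1 l] finM[OF M] by blast
      show "finite T2" using that finite_tubing[of "V - M" T2 l] fin by blast
      have "A \<subseteq> M" if "A \<in> T1" for A using that \<open>T1 \<in> ?R M\<close> tubing_subset by blast
      moreover have "A \<subseteq> V - M \<and> A \<noteq> {}" if "A \<in> T2" for A
        using that tubing_subset[OF \<open>T2 \<in> _\<close>] tubing_nonempty[OF \<open>T2 \<in> _\<close>] by blast
      ultimately show "T1 \<inter> T2 = {}" by blast
    qed
    show "(\<Sum>(T1, T2)\<in>?R M \<times> tubings l (V - M). t ^ card (T1 \<union> T2)) =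
        rooted_sum t l M * tubing_sum t l (V - M)"
      unfolding rooted_sum_def tubing_sum_def sum_product sum.cartesian_product
      by (rule sum.cong) (auto simp: card power_add)
  qed
  ultimately show ?thesis by (simp add: tubing_sum_def)
qed

text \<open>
  The factor \<open>t / (1 + t)\<close> turns the tubings of the largest tube \<open>K \<union> B\<close> into those that contain it.
  The term with \<open>B = N\<close> and \<open>K = V\<close> is the left-hand side again; since \<open>t / (1 + t) \<noteq> 1\<close>, the equation
  still determines the tubing sum.
\<close>

lemma tubing_sum_recursion:
  assumes fin: "finite (V \<union> N)" and t: "t > 0"
  shows "tubing_sum t l (V \<union> N) = tubing_sum t l V +
    t / (1 + t) * (\<Sum>B\<in>Pow N - {{}}. \<Sum>K\<in>upsets l V - {{}}.
       tubing_sum t l (K \<union> B) * tubing_sum t l (V - K))"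
proof -
  let ?I = "{M. tube l (V \<union> N) M \<and> M \<inter> N \<noteq> {}}"
  have disj: "V \<inter> N = {}" using sep by blast
  have r: "rooted_sum t l M = t / (1 + t) * tubing_sum t l M" if "M \<in> ?I" for M
  proof -
    have "finite M" using that fin by (auto simp: tube_def intro: finite_subset)
    moreover obtain x y where "x \<in> M" "y \<in> M" "l x < l y"
      using \<open>M \<in> ?I\<close> unfolding tube_def by blast
    ultimately show ?thesis
      using rooted_sum_proper_sum[of M x y l t] tubing_sum_proper_sum[of M x y l t] t
      by (simp add: field_simps)
  qed
  have "(\<Sum>M\<in>?I. rooted_sum t l M * tubing_sum t l (V - M)) =
      t / (1 + t) * (\<Sum>M\<in>?I. tubing_sum t l M * tubing_sum t l (V - M))"
    by (simp add: r sum_distrib_left mult.assoc)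
  also have "(\<Sum>M\<in>?I. tubing_sum t l M * tubing_sum t l (V - M)) =
      (\<Sum>(B, K)\<in>(Pow N - {{}}) \<times> (upsets l V - {{}}).
         tubing_sum t l (K \<union> B) * tubing_sum t l (V - (K \<union> B)))"
    using sum.reindex_bij_betw[OF bij_betw_top_tubes[OF sep N],
        where g = "\<lambda>M. tubing_sum t l M * tubing_sum t l (V - M)"]
    by (simp add: split_beta)
  also have "\<dots> = (\<Sum>(B, K)\<in>(Pow N - {{}}) \<times> (upsets l V - {{}}).
         tubing_sum t l (K \<union> B) * tubing_sum t l (V - K))"
  proof (rule sum.cong[OF refl])
    fix z assume "z \<in> (Pow N - {{}}) \<times> (upsets l V - {{}})"
    then have "V - (snd z \<union> fst z) = V - snd z" using disj by auto
    then show "(case z of (B, K) \<Rightarrow> tubing_sum t l (K \<union> B) * tubing_sum t l (V - (K \<union> B))) =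
        (case z of (B, K) \<Rightarrow> tubing_sum t l (K \<union> B) * tubing_sum t l (V - K))"
      by (simp add: split_beta)
  qed
  finally show ?thesis
    using tubing_sum_top_tube[OF fin] by (simp add: sum.cartesian_product)
qed

end

section \<open>Chain sums and power series in them\<close>

text \<open>
  A nonempty upset of an ordinal sum either stays inside the upper summand or contains all of it.
\<close>

lemma sum_upsets_ordinal_sum:
  fixes f :: "'v set \<Rightarrow> real"
  assumes fin: "finite P" "finite Q" and less: "\<And>x y. x \<in> P \<Longrightarrow> y \<in> Q \<Longrightarrow> l x < l y"
  shows "(\<Sum>K\<in>upsets l (P \<union> Q) - {{}}. f K) =
    (\<Sum>K\<in>upsets l Q - {{}}. f K) + (\<Sum>K\<in>upsets l P - {{}}. f (K \<union> Q))"
proof -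
  have disj: "P \<inter> Q = {}" using less by blast
  have nl: "\<not> l y < l x" if "x \<in> P" "y \<in> Q" for x y using less[OF that] by simp
  have "upsets l (P \<union> Q) - {{}} = (upsets l Q - {{}}) \<union> (\<lambda>K. K \<union> Q) ` (upsets l P - {{}})"
  proof (intro subset_antisym subsetI)
    fix K assume K: "K \<in> upsets l (P \<union> Q) - {{}}"
    show "K \<in> (upsets l Q - {{}}) \<union> (\<lambda>K. K \<union> Q) ` (upsets l P - {{}})"
    proof (cases "K \<subseteq> Q")
      case True
      then show ?thesis using K unfolding upsets_def by blast
    next
      case False
      then have "K \<inter> P \<noteq> {}" using K unfolding upsets_def by blast
      moreover from this have "Q \<subseteq> K" using K less unfolding upsets_def by blast
      moreover have "K \<inter> P \<in> upsets l P" "K \<subseteq> P \<union> Q" using K unfolding upsets_def by blast+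
      ultimately show ?thesis by (intro UnI2 image_eqI[of _ _ "K \<inter> P"]) auto
    qed
  next
    fix K assume "K \<in> (upsets l Q - {{}}) \<union> (\<lambda>K. K \<union> Q) ` (upsets l P - {{}})"
    then consider "K \<in> upsets l Q" "K \<noteq> {}" | C where "C \<in> upsets l P" "C \<noteq> {}" "K = C \<union> Q"
      by blast
    then show "K \<in> upsets l (P \<union> Q) - {{}}"
    proof cases
      case 1
      then show ?thesis using nl unfolding upsets_def by blast
    next
      case 2
      then show ?thesis using nl unfolding upsets_def by blast
    qed
  qed
  moreover have "(upsets l Q - {{}}) \<inter> (\<lambda>K. K \<union> Q) ` (upsets l P - {{}}) = {}"
    using disj unfolding upsets_def by blast
  moreover have "inj_on (\<lambda>K. K \<union> Q) (upsets l P - {{}})"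
  proof (rule inj_onI)
    fix A B assume "A \<in> upsets l P - {{}}" "B \<in> upsets l P - {{}}" "A \<union> Q = B \<union> Q"
    then show "A = B" using disj unfolding upsets_def by blast
  qed
  ultimately show ?thesis
    by (simp add: sum.union_disjoint sum.reindex finite_upsets fin)
qed

lemma upsets_cong:
  assumes "\<And>x y. x \<in> V \<Longrightarrow> y \<in> V \<Longrightarrow> l x < l y \<longleftrightarrow> l' x < l' y"
  shows "upsets l V = upsets l' V"
  unfolding upsets_def using assms by (intro Collect_cong conj_cong refl ball_cong) (auto simp: subset_iff)

lemma upsets_dual:
  assumes "\<And>x y. x \<in> V \<Longrightarrow> y \<in> V \<Longrightarrow> l x < l y \<longleftrightarrow> l' y < l' x"
  shows "Y \<in> upsets l' V \<longleftrightarrow> Y \<subseteq> V \<and> V - Y \<in> upsets l V"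
  using assms unfolding upsets_def by blast

lemma upsets_chain:
  "Y \<in> upsets l S \<and> Z \<in> upsets l Y \<longleftrightarrow> Z \<subseteq> Y \<and> Z \<in> upsets l S \<and> Y - Z \<in> upsets l (S - Z)"
  unfolding upsets_def by blast

text \<open>
  Upsets give a convolution of set functions, \<open>\<Sum>Y\<in>upsets l S. f Y * g (S - Y)\<close>, and the chain sum of
  index \<open>k\<close> is the \<open>k\<close>-th convolution power of the tubing sum with its value at the empty set
  replaced by \<open>0\<close>. Equivalently, it sums over the chains of upsets that cut \<open>S\<close> into \<open>k\<close> nonempty blocks
  the product of the tubing sums of the blocks.
\<close>

fun chain_sum :: "real \<Rightarrow> ('v \<Rightarrow> int) \<Rightarrow> nat \<Rightarrow> 'v set \<Rightarrow> real" where
  "chain_sum t l 0 S = (if S = {} then 1 else 0)"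
| "chain_sum t l (Suc k) S =
     (\<Sum>Y\<in>upsets l S - {{}}. tubing_sum t l Y * chain_sum t l k (S - Y))"

lemma empty_upset [simp]: "{} \<in> upsets l S" and self_upset [simp]: "S \<in> upsets l S"
  by (auto simp: upsets_def)

lemma upset_subset: "Y \<in> upsets l S \<Longrightarrow> Y \<subseteq> S"
  by (simp add: upsets_def)

lemma chain_sum_1:
  assumes "finite S"
  shows "chain_sum t l 1 S = (if S = {} then 0 else tubing_sum t l S)"
proof (cases "S = {}")
  case True
  then show ?thesis by (simp add: upsets_def)
next
  case False
  have "chain_sum t l 1 S = (\<Sum>Y\<in>upsets l S - {{}}. if Y = S then tubing_sum t l S else 0)"
    unfolding One_nat_def chain_sum.simps
    by (rule sum.cong) (auto dest: upset_subset)
  then show ?thesis using False assms by (simp add: finite_upsets)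
qed

text \<open>
  Powers multiply: a chain with \<open>i + j\<close> steps is cut at its \<open>i\<close>-th member. The induction step is
  associativity of the convolution.
\<close>

lemma chain_sum_convolution:
  assumes "finite S"
  shows "(\<Sum>Y\<in>upsets l S. chain_sum t l i Y * chain_sum t l j (S - Y)) = chain_sum t l (i + j) S"
  using assms
proof (induction i arbitrary: S)
  case 0
  have "(\<Sum>Y\<in>upsets l S. chain_sum t l 0 Y * chain_sum t l j (S - Y)) =
      (\<Sum>Y\<in>upsets l S. if Y = {} then chain_sum t l j S else 0)"
    by (rule sum.cong) auto
  then show ?case using 0 by (simp add: finite_upsets)
next
  case (Suc i)
  let ?F = "\<lambda>Z X R. tubing_sum t l Z * chain_sum t l i X * chain_sum t l j R"
  have fin: "finite (upsets l Y)" if "Y \<subseteq> S" for Y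
    using that Suc.prems finite_subset finite_upsets by blast
  have "(\<Sum>Y\<in>upsets l S. chain_sum t l (Suc i) Y * chain_sum t l j (S - Y)) =
      (\<Sum>Y\<in>upsets l S. \<Sum>Z\<in>upsets l Y - {{}}. ?F Z (Y - Z) (S - Y))"
    by (simp add: sum_distrib_right)
  also have "\<dots> = (\<Sum>(Y, Z)\<in>(SIGMA Y:upsets l S. upsets l Y - {{}}). ?F Z (Y - Z) (S - Y))"
    by (rule sum.Sigma) (auto simp: fin upset_subset)
  also have "\<dots> = (\<Sum>(Z, X)\<in>(SIGMA Z:upsets l S - {{}}. upsets l (S - Z)). ?F Z X (S - Z - X))"
  proof (rule sum.reindex_bij_witness[where j = "\<lambda>(Y, Z). (Z, Y - Z)" and i = "\<lambda>(Z, X). (X \<union> Z, Z)"], goal_cases)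
    case (1 p)
    then show ?case by (auto simp: upsets_def)
  next
    case (2 p)
    then show ?case using upsets_chain[of "fst p" l S "snd p"] by auto
  next
    case (3 p)
    then show ?case by (auto simp: upsets_def)
  next
    case (4 p)
    then have "snd p \<subseteq> S - fst p" by (auto simp: upsets_def)
    then have "snd p \<union> fst p - fst p = snd p" by blast
    then show ?case using 4 upsets_chain[of "snd p \<union> fst p" l S "fst p"] by auto
  next
    case (5 p)
    then have "snd p \<subseteq> fst p" by (auto simp: upsets_def)
    then have "S - snd p - (fst p - snd p) = S - fst p" by blast
    then show ?case by (simp add: split_beta)
  qed
  also have "\<dots> = (\<Sum>Z\<in>upsets l S - {{}}. \<Sum>X\<in>upsets l (S - Z). ?F Z X (S - Z - X))"
    by (rule sum.Sigma[symmetric]) (auto simp: fin)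
  also have "\<dots> = (\<Sum>Z\<in>upsets l S - {{}}. tubing_sum t l Z * chain_sum t l (i + j) (S - Z))"
    using Suc.prems by (simp add: Suc.IH[symmetric] sum_distrib_left mult.assoc)
  finally show ?case by simp
qed

text \<open>
  Complements turn a chain of upsets into a chain of upsets of the dual poset with the same blocks in
  the opposite order, and the tubing sum of each block is self-dual. In the induction, a first block
  of the dual becomes a last block, which can be moved to the front because powers commute.
\<close>

lemma chain_sum_dual:
  assumes "finite S" "\<And>x y. x \<in> S \<Longrightarrow> y \<in> S \<Longrightarrow> l x < l y \<longleftrightarrow> l' y < l' x"
  shows "chain_sum t l' k S = chain_sum t l k S"
  using assms
proof (induction k arbitrary: S)
  case 0
  then show ?case by simp
next
  case (Suc k)
  have "chain_sum t l' (Suc k) S = (\<Sum>Y\<in>upsets l' S - {{}}. tubing_sum t l Y * chain_sum t l k (S - Y))"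
    unfolding chain_sum.simps
  proof (rule sum.cong[OF refl])
    fix Y assume "Y \<in> upsets l' S - {{}}"
    then have "Y \<subseteq> S" by (auto dest: upset_subset)
    then show "tubing_sum t l' Y * chain_sum t l' k (S - Y) = tubing_sum t l Y * chain_sum t l k (S - Y)"
      using Suc.prems Suc.IH[of "S - Y"] tubing_sum_dual[of Y l l' t] by (auto simp: subset_iff)
  qed
  also have "\<dots> = (\<Sum>Z\<in>upsets l S - {S}. chain_sum t l k Z * tubing_sum t l (S - Z))"
  proof (rule sum.reindex_bij_witness[where i = "\<lambda>Z. S - Z" and j = "\<lambda>Y. S - Y"], goal_cases)
    case (1 Y)
    then show ?case by (auto dest: upset_subset)
  next
    case (2 Y)
    then show ?case using upsets_dual[of S l l' Y] Suc.prems(2) by (auto dest: upset_subset)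
  next
    case (3 Z)
    then show ?case by (auto dest: upset_subset)
  next
    case (4 Z)
    then have "S - (S - Z) = Z" by (auto dest: upset_subset)
    then show ?case using 4 upsets_dual[of S l l' "S - Z"] Suc.prems(2) by (auto dest: upset_subset)
  next
    case (5 Y)
    then have "S - (S - Y) = Y" by (auto dest: upset_subset)
    then show ?case by simp
  qed
  also have "\<dots> = (\<Sum>Z\<in>upsets l S. chain_sum t l k Z * chain_sum t l 1 (S - Z))"
  proof (rule sum.mono_neutral_cong_left)
    show "\<forall>Z\<in>upsets l S - (upsets l S - {S}). chain_sum t l k Z * chain_sum t l 1 (S - Z) = 0"
      using chain_sum_1[of "{}" t l] by auto
    show "chain_sum t l k Z * tubing_sum t l (S - Z) = chain_sum t l k Z * chain_sum t l 1 (S - Z)"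
      if "Z \<in> upsets l S - {S}" for Z
      using that chain_sum_1[of "S - Z" t l] Suc.prems(1) by (auto dest: upset_subset)
  qed (auto simp: finite_upsets Suc.prems)
  also have "\<dots> = chain_sum t l (Suc k) S"
    using chain_sum_convolution[OF Suc.prems(1), of t l k 1] by simp
  finally show ?case .
qed

lemma chain_sum_eq_0:
  assumes "finite S" "card S < k"
  shows "chain_sum t l k S = 0"
  using assms
proof (induction k arbitrary: S)
  case (Suc k)
  have "chain_sum t l k (S - Y) = 0" if "Y \<in> upsets l S - {{}}" for Y
  proof -
    have "S - Y \<subset> S" using that by (auto dest: upset_subset)
    then have "card (S - Y) < card S" using Suc.prems(1) by (rule psubset_card_mono[rotated])
    then show ?thesis using Suc by simp
  qed
  then show ?case by simp
qed simp

text \<open>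
  Formal power series are evaluated at the convolution powers. The sum is finite because chain sums
  vanish beyond the cardinality of \<open>S\<close>. On finite sets, the evaluation turns products of power series
  into convolutions.
\<close>

definition chain_series :: "real \<Rightarrow> ('v \<Rightarrow> int) \<Rightarrow> real fps \<Rightarrow> 'v set \<Rightarrow> real" where
  "chain_series t l c S = (\<Sum>k\<le>card S. fps_nth c k * chain_sum t l k S)"

lemma chain_series_bound:
  assumes "finite S" "card S \<le> n"
  shows "chain_series t l c S = (\<Sum>k\<le>n. fps_nth c k * chain_sum t l k S)"
  unfolding chain_series_def
  by (rule sum.mono_neutral_left) (use assms chain_sum_eq_0[of S] in auto)

lemma chain_series_add: "chain_series t l (c + d) S = chain_series t l c S + chain_series t l d S"
  by (simp add: chain_series_def algebra_simps sum.distrib)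

lemma chain_series_scale: "chain_series t l (fps_const a * c) S = a * chain_series t l c S"
  by (simp add: chain_series_def sum_distrib_left mult.assoc)

lemma chain_series_dual:
  assumes "finite S" "\<And>x y. x \<in> S \<Longrightarrow> y \<in> S \<Longrightarrow> l x < l y \<longleftrightarrow> l' y < l' x"
  shows "chain_series t l' c S = chain_series t l c S"
  unfolding chain_series_def using chain_sum_dual[OF assms] by simp

lemma chain_series_mult:
  assumes "finite S"
  shows "chain_series t l (c * d) S =
    (\<Sum>Y\<in>upsets l S. chain_series t l c Y * chain_series t l d (S - Y))"
proof -
  let ?n = "card S"
  have "(\<Sum>Y\<in>upsets l S. chain_series t l c Y * chain_series t l d (S - Y)) =
    (\<Sum>Y\<in>upsets l S. \<Sum>i\<le>?n. \<Sum>j\<le>?n. fps_nth c i * fps_nth d j *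
      (chain_sum t l i Y * chain_sum t l j (S - Y)))"
  proof (rule sum.cong[OF refl])
    fix Y assume "Y \<in> upsets l S"
    then have Y: "Y \<subseteq> S" by (rule upset_subset)
    have "chain_series t l c Y = (\<Sum>k\<le>?n. fps_nth c k * chain_sum t l k Y)"
      using assms Y by (intro chain_series_bound) (auto intro: card_mono finite_subset)
    moreover have "chain_series t l d (S - Y) = (\<Sum>k\<le>?n. fps_nth d k * chain_sum t l k (S - Y))"
      using assms by (intro chain_series_bound) (auto intro: card_mono)
    ultimately show "chain_series t l c Y * chain_series t l d (S - Y) =
      (\<Sum>i\<le>?n. \<Sum>j\<le>?n. fps_nth c i * fps_nth d j * (chain_sum t l i Y * chain_sum t l j (S - Y)))"
      by (simp add: sum_product mult_ac)
  qed
  also have "\<dots> = (\<Sum>i\<le>?n. \<Sum>j\<le>?n. fps_nth c i * fps_nth d j * chain_sum t l (i + j) S)"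
    unfolding chain_sum_convolution[OF assms, symmetric] sum_distrib_left
    by (subst sum.swap, rule sum.cong[OF refl], rule sum.swap)
  also have "\<dots> = (\<Sum>(i, j)\<in>{..?n} \<times> {..?n}. fps_nth c i * fps_nth d j * chain_sum t l (i + j) S)"
    by (rule sum.cartesian_product)
  also have "\<dots> = (\<Sum>(i, j)\<in>{(i, j). i + j \<le> ?n}. fps_nth c i * fps_nth d j * chain_sum t l (i + j) S)"
  proof (rule sum.mono_neutral_right)
    show "\<forall>p\<in>{..?n} \<times> {..?n} - {(i, j). i + j \<le> ?n}.
        (case p of (i, j) \<Rightarrow> fps_nth c i * fps_nth d j * chain_sum t l (i + j) S) = 0"
    proof
      fix p assume "p \<in> {..?n} \<times> {..?n} - {(i, j). i + j \<le> ?n}"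
      then have "?n < fst p + snd p" by auto
      then show "(case p of (i, j) \<Rightarrow> fps_nth c i * fps_nth d j * chain_sum t l (i + j) S) = 0"
        by (simp add: split_beta chain_sum_eq_0[OF assms])
    qed
  qed auto
  also have "\<dots> = (\<Sum>k\<le>?n. \<Sum>i\<le>k. fps_nth c i * fps_nth d (k - i) * chain_sum t l k S)"
    by (simp add: sum.triangle_reindex_eq)
  also have "\<dots> = chain_series t l (c * d) S"
    by (simp add: chain_series_def fps_mult_nth sum_distrib_right atLeast0AtMost)
  finally show ?thesis ..
qed

text \<open>
  The empty set has tubing sum \<open>1\<close>, which accounts for the constant term.
\<close>

lemma chain_series_tubing_sum:
  assumes "finite S"
  shows "chain_series t l (1 + fps_X) S = tubing_sum t l S"
proof (cases "S = {}")
  case True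
  then show ?thesis by (simp add: chain_series_def tubing_sum_empty)
next
  case False
  then have "1 \<le> card S" using assms by (simp add: Suc_leI card_gt_0_iff)
  then have "(\<Sum>k\<le>card S. (if k = 1 then chain_sum t l 1 S else 0)) = chain_sum t l 1 S" by simp
  moreover have "fps_nth (1 + fps_X) k * chain_sum t l k S = (if k = 1 then chain_sum t l 1 S else 0)" for k
    using False by (cases k) auto
  ultimately show ?thesis using False chain_sum_1[OF assms] unfolding chain_series_def by simp
qed

section \<open>A levelled set between two others\<close>

text \<open>
  A function of a levelled set is a power series in the chain sums, with coefficients that are the
  same for all levelled sets that satisfy \<open>Q\<close>. Such functions take the same value at a finite
  levelled set and at its dual, if both satisfy \<open>Q\<close>.
\<close>

definition expands :: "real \<Rightarrow> (('v \<Rightarrow> int) \<Rightarrow> 'v set \<Rightarrow> bool) \<Rightarrow> (('v \<Rightarrow> int) \<Rightarrow> 'v set \<Rightarrow> real) \<Rightarrow> bool" where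
  "expands t Q f \<longleftrightarrow> (\<exists>c. \<forall>l S. Q l S \<longrightarrow> f l S = chain_series t l c S)"

lemma expands_cong:
  assumes "expands t Q f" "\<And>l S. Q' l S \<Longrightarrow> Q l S \<and> f' l S = f l S"
  shows "expands t Q' f'"
  using assms unfolding expands_def by metis

lemma expands_add: "expands t Q f \<Longrightarrow> expands t Q g \<Longrightarrow> expands t Q (\<lambda>l S. f l S + g l S)"
  unfolding expands_def by (metis chain_series_add)

lemma expands_scale: "expands t Q f \<Longrightarrow> expands t Q (\<lambda>l S. a * f l S)"
  unfolding expands_def by (metis chain_series_scale)

lemma expands_zero: "expands t Q (\<lambda>l S. 0)"
  unfolding expands_def by (intro exI[of _ 0]) (simp add: chain_series_def)

lemma expands_sum:
  assumes "\<And>i. i \<in> I \<Longrightarrow> expands t Q (f i)"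
  shows "expands t Q (\<lambda>l S. \<Sum>i\<in>I. f i l S)"
proof (cases "finite I")
  case True
  then show ?thesis using assms
  proof (induction I)
    case empty
    then show ?case by (simp add: expands_zero)
  next
    case (insert i I)
    then show ?case by (simp add: expands_add)
  qed
qed (simp add: expands_zero)

lemma expands_convolution:
  assumes f: "expands t Q f" and g: "expands t Q g"
    and Q: "\<And>l S Y. Q l S \<Longrightarrow> finite S \<and> (Y \<subseteq> S \<longrightarrow> Q l Y)"
  shows "expands t Q (\<lambda>l S. \<Sum>Y\<in>upsets l S. f l Y * g l (S - Y))"
proof -
  obtain c d where c: "\<And>l S. Q l S \<Longrightarrow> f l S = chain_series t l c S"
    and d: "\<And>l S. Q l S \<Longrightarrow> g l S = chain_series t l d S"
    using f g unfolding expands_def by blast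
  have "(\<Sum>Y\<in>upsets l S. f l Y * g l (S - Y)) = chain_series t l (c * d) S" if "Q l S" for l S
  proof -
    have "f l Y * g l (S - Y) = chain_series t l c Y * chain_series t l d (S - Y)"
      if "Y \<in> upsets l S" for Y
      using c[of l Y] d[of l "S - Y"] Q[OF \<open>Q l S\<close>] upset_subset[OF that] by simp
    then show ?thesis using Q[OF that] by (simp add: chain_series_mult)
  qed
  then show ?thesis unfolding expands_def by blast
qed

text \<open>
  The equation determines \<open>f\<close>, because the only summand on the right that involves \<open>f\<close> at \<open>S\<close> itself
  has coefficient \<open>s \<noteq> 1\<close>. On the level of power series it reads \<open>c = d + s * c * (1 + X)\<close>, which is
  solvable since \<open>1 - s * (1 + X)\<close> is invertible.
\<close>

lemma expands_fixpoint:
  assumes r: "expands t Q r" and s: "s \<noteq> 1"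
    and f: "\<And>l S. Q l S \<Longrightarrow> f l S = r l S + s * (\<Sum>Y\<in>upsets l S. f l Y * tubing_sum t l (S - Y))"
    and Q: "\<And>l S Y. Q l S \<Longrightarrow> finite S \<and> (Y \<subseteq> S \<longrightarrow> Q l Y)"
  shows "expands t Q f"
proof -
  obtain d where d: "\<And>l S. Q l S \<Longrightarrow> r l S = chain_series t l d S"
    using r unfolding expands_def by blast
  define e where "e = 1 - fps_const s * (1 + fps_X)"
  define c where "c = d * inverse e"
  have "inverse e * e = 1" by (rule inverse_mult_eq_1) (simp add: e_def s)
  then have "c * e = d" by (simp add: c_def mult.assoc)
  then have c: "c = d + fps_const s * (c * (1 + fps_X))" by (simp add: e_def algebra_simps)
  have "f l S = chain_series t l c S" if "Q l S" for l S
    using that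
  proof (induction "card S" arbitrary: S rule: less_induct)
    case less
    have S: "finite S" using Q[OF less.prems] by blast
    let ?U = "upsets l S"
    have U: "finite ?U" "S \<in> ?U" using S by (simp_all add: finite_upsets)
    have eq: "f l Y = chain_series t l c Y" if "Y \<in> ?U - {S}" for Y
    proof (rule less.hyps)
      have "Y \<subset> S" using that by (auto dest: upset_subset)
      then show "card Y < card S" "Q l Y" using S Q[OF less.prems] by (auto intro: psubset_card_mono)
    qed
    let ?g = "\<lambda>Y. tubing_sum t l (S - Y)"
    have "f l S = chain_series t l d S + s * (f l S + (\<Sum>Y\<in>?U - {S}. f l Y * ?g Y))"
      using f[OF less.prems] d[OF less.prems] sum.remove[OF U, of "\<lambda>Y. f l Y * ?g Y"]
      by (simp add: tubing_sum_empty)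
    then have 1: "(1 - s) * f l S =
        chain_series t l d S + s * (\<Sum>Y\<in>?U - {S}. chain_series t l c Y * ?g Y)"
      using eq by (simp add: algebra_simps)
    have "chain_series t l c S = chain_series t l (d + fps_const s * (c * (1 + fps_X))) S"
      by (simp only: c[symmetric])
    also have "\<dots> = chain_series t l d S + s * chain_series t l (c * (1 + fps_X)) S"
      by (simp only: chain_series_add chain_series_scale)
    also have "chain_series t l (c * (1 + fps_X)) S = (\<Sum>Y\<in>?U. chain_series t l c Y * ?g Y)"
      by (simp only: chain_series_mult[OF S] chain_series_tubing_sum[OF finite_Diff[OF S]])
    finally have "chain_series t l c S =
        chain_series t l d S + s * (\<Sum>Y\<in>?U. chain_series t l c Y * ?g Y)" .
    then have "(1 - s) * chain_series t l c S =
        chain_series t l d S + s * (\<Sum>Y\<in>?U - {S}. chain_series t l c Y * ?g Y)"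
      using sum.remove[OF U, of "\<lambda>Y. chain_series t l c Y * ?g Y"]
      by (simp add: tubing_sum_empty algebra_simps)
    then have "(1 - s) * f l S = (1 - s) * chain_series t l c S" by (simp only: 1)
    then show ?case using s by simp
  qed
  then show ?thesis unfolding expands_def by blast
qed

text \<open>
  The set \<open>S\<close> is inserted between the fixed levelled sets \<open>W\<close> (below) and \<open>U\<close> (above), whose levels are
  those given by \<open>l0\<close>.
\<close>

definition fits :: "('v \<Rightarrow> int) \<Rightarrow> 'v set \<Rightarrow> 'v set \<Rightarrow> ('v \<Rightarrow> int) \<Rightarrow> 'v set \<Rightarrow> bool" where
  "fits l0 W U l S \<longleftrightarrow> finite S \<and> (\<forall>x\<in>W \<union> U. l x = l0 x) \<and>
     (\<forall>w\<in>W. \<forall>x\<in>S. l w < l x) \<and> (\<forall>x\<in>S. \<forall>u\<in>U. l x < l u)"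

lemma fits_mono:
  "fits l0 W U l S \<Longrightarrow> W' \<subseteq> W \<Longrightarrow> U' \<subseteq> U \<Longrightarrow> S' \<subseteq> S \<Longrightarrow> fits l0 W' U' l S'"
  unfolding fits_def by (meson Un_mono finite_subset subsetD)

lemma fits_hereditary: "fits l0 W U l S \<Longrightarrow> finite S \<and> (Y \<subseteq> S \<longrightarrow> fits l0 W U l Y)"
proof (intro conjI impI)
  show "finite S" if "fits l0 W U l S" using that unfolding fits_def by blast
qed (rule fits_mono[of l0 W U l S W U Y], auto)

text \<open>
  The recursion for \<open>W \<union> S \<union> (U \<union> N)\<close> with top level \<open>N\<close>, where the upsets \<open>K\<close> are classified by the
  lowest of \<open>U\<close>, \<open>S\<close>, \<open>W\<close> that they reach. Only in the middle case is \<open>S\<close> divided, and there the sum is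
  a convolution; its term with an empty upset of \<open>S\<close> belongs to the first case or to none, and is
  subtracted.
\<close>

lemma tubing_sum_sandwich_recursion:
  fixes l l0 :: "'v \<Rightarrow> int"
  assumes fits: "fits l0 W (U \<union> N) l S" and fin: "finite W" "finite (U \<union> N)" and t: "t > 0"
    and WU: "\<And>x y. x \<in> W \<Longrightarrow> y \<in> U \<union> N \<Longrightarrow> l0 x < l0 y"
    and sep: "\<And>x y. x \<in> U \<Longrightarrow> y \<in> N \<Longrightarrow> l0 x < l0 y" and N: "\<And>x y. x \<in> N \<Longrightarrow> y \<in> N \<Longrightarrow> l0 x = l0 y"
    and ne: "N \<noteq> {}"
  shows "tubing_sum t l (W \<union> S \<union> (U \<union> N)) = tubing_sum t l (W \<union> S \<union> U) + t / (1 + t) *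
    (\<Sum>B\<in>Pow N - {{}}.
      (\<Sum>K\<in>upsets l0 U - {{}}. tubing_sum t l0 (K \<union> B) * tubing_sum t l (W \<union> S \<union> (U - K)))
      + ((\<Sum>Y\<in>upsets l S. tubing_sum t l (Y \<union> (U \<union> B)) * tubing_sum t l (W \<union> (S - Y)))
         - tubing_sum t l0 (U \<union> B) * tubing_sum t l (W \<union> S))
      + (\<Sum>C\<in>upsets l0 W - {{}}. tubing_sum t l0 (W - C) * tubing_sum t l (C \<union> S \<union> (U \<union> B))))"
proof -
  let ?g = "tubing_sum t l" and ?V = "W \<union> S \<union> U"
  have finS: "finite S" and eq: "\<And>x. x \<in> W \<union> (U \<union> N) \<Longrightarrow> l x = l0 x"
    and WS: "\<And>x y. x \<in> W \<Longrightarrow> y \<in> S \<Longrightarrow> l x < l y" and SU: "\<And>x y. x \<in> S \<Longrightarrow> y \<in> U \<union> N \<Longrightarrow> l x < l y"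
    using fits unfolding fits_def by blast+
  have g0: "?g A = tubing_sum t l0 A" if "A \<subseteq> W \<union> (U \<union> N)" for A
    by (rule tubing_sum_cong) (use that eq in \<open>auto simp: subset_iff\<close>)
  have u0: "upsets l A = upsets l0 A" if "A \<subseteq> W \<union> (U \<union> N)" for A
    by (rule upsets_cong) (use that eq in \<open>auto simp: subset_iff\<close>)
  have disj: "W \<inter> S = {}" "W \<inter> U = {}" "S \<inter> U = {}"
    using WS SU WU by blast+
  have sep': "l x < l y" if "x \<in> ?V" "y \<in> N" for x y
    using that SU[of x y] sep[of x y] WU[of x y] eq[of x] eq[of y] by auto
  have WU': "l x < l y" if "x \<in> W" "y \<in> U" for x y
    using that WU[of x y] eq[of x] eq[of y] by auto
  have inner: "(\<Sum>K\<in>upsets l ?V - {{}}. ?g (K \<union> B) * ?g (?V - K)) =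
      (\<Sum>K\<in>upsets l0 U - {{}}. tubing_sum t l0 (K \<union> B) * ?g (W \<union> S \<union> (U - K)))
      + ((\<Sum>Y\<in>upsets l S. ?g (Y \<union> (U \<union> B)) * ?g (W \<union> (S - Y)))
         - tubing_sum t l0 (U \<union> B) * ?g (W \<union> S))
      + (\<Sum>C\<in>upsets l0 W - {{}}. tubing_sum t l0 (W - C) * ?g (C \<union> S \<union> (U \<union> B)))"
    if B: "B \<subseteq> N" for B
  proof -
    let ?f = "\<lambda>K. ?g (K \<union> B) * ?g (?V - K)"
    have "(\<Sum>K\<in>upsets l (W \<union> (S \<union> U)) - {{}}. ?f K) =
        (\<Sum>K\<in>upsets l (S \<union> U) - {{}}. ?f K) + (\<Sum>C\<in>upsets l W - {{}}. ?f (C \<union> (S \<union> U)))"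
      by (rule sum_upsets_ordinal_sum) (use fin finS WS WU' in auto)
    moreover have "(\<Sum>K\<in>upsets l (S \<union> U) - {{}}. ?f K) =
        (\<Sum>K\<in>upsets l U - {{}}. ?f K) + (\<Sum>Y\<in>upsets l S - {{}}. ?f (Y \<union> U))"
      by (rule sum_upsets_ordinal_sum) (use fin finS SU in auto)
    moreover have "(\<Sum>K\<in>upsets l U - {{}}. ?f K) =
        (\<Sum>K\<in>upsets l0 U - {{}}. tubing_sum t l0 (K \<union> B) * ?g (W \<union> S \<union> (U - K)))"
    proof (rule sum.cong)
      show "upsets l U - {{}} = upsets l0 U - {{}}" using u0[of U] by auto
      fix K assume "K \<in> upsets l0 U - {{}}"
      then have "K \<subseteq> U" by (auto dest: upset_subset)
      then have "?V - K = W \<union> S \<union> (U - K)" "K \<union> B \<subseteq> W \<union> (U \<union> N)" using disj B by blast+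
      then show "?f K = tubing_sum t l0 (K \<union> B) * ?g (W \<union> S \<union> (U - K))" using g0 by simp
    qed
    moreover have "(\<Sum>Y\<in>upsets l S - {{}}. ?f (Y \<union> U)) =
        (\<Sum>Y\<in>upsets l S. ?g (Y \<union> (U \<union> B)) * ?g (W \<union> (S - Y))) - tubing_sum t l0 (U \<union> B) * ?g (W \<union> S)"
    proof -
      have "?f (Y \<union> U) = ?g (Y \<union> (U \<union> B)) * ?g (W \<union> (S - Y))" if "Y \<in> upsets l S" for Y
      proof -
        have "?V - (Y \<union> U) = W \<union> (S - Y)" using upset_subset[OF that] disj by blast
        then show ?thesis by (simp add: Un_assoc)
      qed
      moreover have "?g (U \<union> B) = tubing_sum t l0 (U \<union> B)" using B by (intro g0) blast
      ultimately show ?thesis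
        using sum.remove[of "upsets l S" "{}" "\<lambda>Y. ?g (Y \<union> (U \<union> B)) * ?g (W \<union> (S - Y))"] finS
        by (simp add: finite_upsets)
    qed
    moreover have "(\<Sum>C\<in>upsets l W - {{}}. ?f (C \<union> (S \<union> U))) =
        (\<Sum>C\<in>upsets l0 W - {{}}. tubing_sum t l0 (W - C) * ?g (C \<union> S \<union> (U \<union> B)))"
    proof (rule sum.cong)
      show "upsets l W - {{}} = upsets l0 W - {{}}" using u0[of W] by auto
      fix C assume "C \<in> upsets l0 W - {{}}"
      then have "C \<subseteq> W" by (auto dest: upset_subset)
      then have "?V - (C \<union> (S \<union> U)) = W - C" using disj by blast
      moreover have "?g (W - C) = tubing_sum t l0 (W - C)" by (rule g0) blast
      ultimately show "?f (C \<union> (S \<union> U)) = tubing_sum t l0 (W - C) * ?g (C \<union> S \<union> (U \<union> B))"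
        by (simp add: Un_assoc)
    qed
    ultimately show ?thesis by (simp add: Un_assoc)
  qed
  have "?g (?V \<union> N) = ?g ?V + t / (1 + t) *
      (\<Sum>B\<in>Pow N - {{}}. \<Sum>K\<in>upsets l ?V - {{}}. ?g (K \<union> B) * ?g (?V - K))"
  proof (rule tubing_sum_recursion[OF sep'])
    show "l x = l y" if "x \<in> N" "y \<in> N" for x y using that N[of x y] eq[of x] eq[of y] by simp
    show "finite (?V \<union> N)" using fin finS by simp
  qed (simp_all add: t)
  also have "?V \<union> N = W \<union> S \<union> (U \<union> N)" by blast
  finally show ?thesis using inner by simp
qed

abbreviation sandwich_sum :: "real \<Rightarrow> 'v set \<Rightarrow> 'v set \<Rightarrow> ('v \<Rightarrow> int) \<Rightarrow> 'v set \<Rightarrow> real" where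
  "sandwich_sum t W U \<equiv> \<lambda>l S. tubing_sum t l (W \<union> S \<union> U)"

text \<open>
  Every summand of the recursion is, by the induction hypothesis, a power series in the chain sums,
  except those that involve \<open>W\<close> and \<open>U\<close> in full. If \<open>W\<close> is nonempty, there is one such summand, a
  multiple of the quantity itself. If \<open>W\<close> is empty, it is a convolution of the quantity with the
  tubing sum, and the fixed point lemma applies.
\<close>

lemma expands_sandwich_step:
  fixes l0 :: "'v \<Rightarrow> int"
  assumes fin: "finite W" "finite U" and t: "t > 0" and ne: "U \<noteq> {}"
    and WU: "\<And>x y. x \<in> W \<Longrightarrow> y \<in> U \<Longrightarrow> l0 x < l0 y"
    and IH: "\<And>W' U'. W' \<subseteq> W \<Longrightarrow> U' \<subseteq> U \<Longrightarrow> card W' + card U' < card W + card U \<Longrightarrow>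
      expands t (fits l0 W' U') (sandwich_sum t W' U')"
  shows "expands t (fits l0 W U) (sandwich_sum t W U)"
proof -
  let ?Q = "fits l0 W U" and ?f = "sandwich_sum t W U"
  define s where "s = t / (1 + t)"
  have s: "s \<noteq> 1" using t by (simp add: s_def field_simps)
  define N where "N = {x \<in> U. l0 x = Max (l0 ` U)}"
  define U' where "U' = U - N"
  have UN: "U = U' \<union> N" and UN': "U' \<inter> N = {}" by (auto simp: N_def U'_def)
  have "Max (l0 ` U) \<in> l0 ` U" using fin ne by (intro Max_in) auto
  then have Nne: "N \<noteq> {}" by (auto simp: N_def)
  have N: "l0 x = l0 y" if "x \<in> N" "y \<in> N" for x y using that by (simp add: N_def)
  have sep: "l0 x < l0 y" if "x \<in> U'" "y \<in> N" for x y
  proof -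
    have "l0 x \<le> Max (l0 ` U)" "l0 x \<noteq> Max (l0 ` U)" using that fin by (auto simp: N_def U'_def)
    then show ?thesis using that by (simp add: N_def)
  qed
  have mono: "expands t ?Q (sandwich_sum t A B)"
    if "A \<subseteq> W" "B \<subseteq> U" "card A + card B < card W + card U" for A B
    by (rule expands_cong[OF IH[OF that]]) (use that fits_mono in blast)
  have less: "card A + card B < card W + card U"
    if "A \<subseteq> W" "B \<subseteq> U" "A \<noteq> W \<or> B \<noteq> U" for A B
    using that fin by (metis add_le_less_mono add_less_le_mono card_mono psubsetI psubset_card_mono)
  define low where "low = (\<lambda>B l S. \<Sum>K\<in>upsets l0 U' - {{}}.
    tubing_sum t l0 (K \<union> B) * sandwich_sum t W (U' - K) l S)"
  define mid where "mid = (\<lambda>B l S. \<Sum>Y\<in>upsets l S.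
    sandwich_sum t {} (U' \<union> B) l Y * sandwich_sum t W {} l (S - Y))"
  define up where "up = (\<lambda>B C l S. tubing_sum t l0 (W - C) * sandwich_sum t C (U' \<union> B) l S)"
  have rec: "?f l S = sandwich_sum t W U' l S + s * (\<Sum>B\<in>Pow N - {{}}.
      low B l S + (mid B l S - tubing_sum t l0 (U' \<union> B) * sandwich_sum t W {} l S)
      + (\<Sum>C\<in>upsets l0 W - {{}}. up B C l S))" if Q: "?Q l S" for l S
  proof -
    have "fits l0 W (U' \<union> N) l S" "finite (U' \<union> N)" using Q fin by (simp_all add: UN[symmetric])
    from tubing_sum_sandwich_recursion[OF this(1) fin(1) this(2) t _ sep N Nne] WU
    show ?thesis unfolding UN[symmetric] low_def mid_def up_def s_def by simp
  qed
  have elow: "expands t ?Q (low B)" for B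
    unfolding low_def
    by (intro expands_sum expands_scale mono less) (use Nne UN UN' in auto)
  have ebase: "expands t ?Q (sandwich_sum t W U')"
    by (intro mono less) (use Nne UN UN' in auto)
  have eW: "expands t ?Q (sandwich_sum t W {})"
    by (intro mono less) (use ne in auto)
  have U'B: "U' \<union> B = U \<longleftrightarrow> B = N" "U' \<union> B \<subseteq> U" if "B \<subseteq> N" for B using that UN UN' by auto
  have neg: "expands t Q (\<lambda>l S. f l S - g l S)" if "expands t Q f" "expands t Q g" for Q f g
    using expands_add[OF that(1) expands_scale[OF that(2), of "-1"]] by simp
  have her: "finite S \<and> (Y \<subseteq> S \<longrightarrow> ?Q l Y)" if "?Q l S" for l S Y
    using fits_hereditary[OF that] .
  show ?thesis
  proof (cases "W = {}")
    case False
    have emid: "expands t ?Q (mid B)" if "B \<subseteq> N" for B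
      unfolding mid_def
      by (rule expands_convolution[OF mono[OF _ _ less] eW her]) (use that U'B False in auto)
    \<comment> \<open>The pair \<open>(N, W)\<close> is the summand in which the tube is the whole poset.\<close>
    define I where "I = (Pow N - {{}}) \<times> (upsets l0 W - {{}})"
    have I: "finite I" "(N, W) \<in> I"
      using fin Nne False finite_subset[of N U] by (auto simp: I_def N_def finite_upsets)
    define r where "r = (\<lambda>l S. sandwich_sum t W U' l S + s * ((\<Sum>B\<in>Pow N - {{}}.
      low B l S + (mid B l S - tubing_sum t l0 (U' \<union> B) * sandwich_sum t W {} l S))
      + (\<Sum>(B, C)\<in>I - {(N, W)}. up B C l S)))"
    have eup: "expands t ?Q (\<lambda>l S. case p of (B, C) \<Rightarrow> up B C l S)" if "p \<in> I - {(N, W)}" for p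
    proof -
      obtain B C where p: "p = (B, C)" by (cases p)
      have "C \<subseteq> W" "U' \<union> B \<subseteq> U" "C \<noteq> W \<or> U' \<union> B \<noteq> U"
        using that U'B[of B] by (auto simp: p I_def dest: upset_subset)
      then show ?thesis unfolding p up_def prod.case by (intro expands_scale mono less)
    qed
    have "expands t ?Q r"
      unfolding r_def
      by (intro expands_add expands_scale expands_sum ebase elow neg eW emid eup) auto
    then have "expands t ?Q (\<lambda>l S. 1 / (1 - s) * r l S)" by (rule expands_scale)
    then show ?thesis
    proof (rule expands_cong)
      fix l S assume Q: "?Q l S"
      have "up N W l S = ?f l S" unfolding up_def UN by (simp add: tubing_sum_empty)
      then have "(\<Sum>(B, C)\<in>I. up B C l S) = ?f l S + (\<Sum>(B, C)\<in>I - {(N, W)}. up B C l S)"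
        using sum.remove[OF I, of "\<lambda>(B, C). up B C l S"] by simp
      moreover have "(\<Sum>(B, C)\<in>I. up B C l S) = (\<Sum>B\<in>Pow N - {{}}. \<Sum>C\<in>upsets l0 W - {{}}. up B C l S)"
        unfolding I_def by (rule sum.cartesian_product[symmetric])
      moreover have "?f l S = sandwich_sum t W U' l S + s * ((\<Sum>B\<in>Pow N - {{}}.
          low B l S + (mid B l S - tubing_sum t l0 (U' \<union> B) * sandwich_sum t W {} l S))
          + (\<Sum>B\<in>Pow N - {{}}. \<Sum>C\<in>upsets l0 W - {{}}. up B C l S))"
        unfolding rec[OF Q] by (simp only: sum.distrib)
      ultimately have "?f l S = r l S + s * ?f l S"
        unfolding r_def by algebra
      then show "?Q l S \<and> ?f l S = 1 / (1 - s) * r l S"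
        using Q s by (simp add: field_simps)
    qed
  next
    case True
    have finN: "finite (Pow N - {{}})" "N \<in> Pow N - {{}}"
      using fin Nne finite_subset[of N U] by (auto simp: N_def)
    \<comment> \<open>For \<open>B = N\<close> the first factor of the convolution is the quantity under consideration.\<close>
    have emid: "expands t ?Q (mid B)" if "B \<in> Pow N - {{}} - {N}" for B
      unfolding mid_def
      by (rule expands_convolution[OF mono[OF _ _ less] eW her]) (use that U'B[of B] in auto)
    define r where "r = (\<lambda>l S. sandwich_sum t W U' l S + s * ((\<Sum>B\<in>Pow N - {{}}.
      low B l S - tubing_sum t l0 (U' \<union> B) * sandwich_sum t W {} l S)
      + (\<Sum>B\<in>Pow N - {{}} - {N}. mid B l S)))"
    have er: "expands t ?Q r"
      unfolding r_def
      by (intro expands_add expands_scale expands_sum ebase elow neg eW emid) auto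
    have "?f l S = r l S + s * (\<Sum>Y\<in>upsets l S. ?f l Y * tubing_sum t l (S - Y))" if Q: "?Q l S" for l S
    proof -
      have nil: "upsets l0 W - {{}} = {}" unfolding True by (auto simp: upsets_def)
      have "mid N l S = (\<Sum>Y\<in>upsets l S. ?f l Y * tubing_sum t l (S - Y))"
        unfolding mid_def True UN by simp
      then have "(\<Sum>B\<in>Pow N - {{}}. mid B l S) =
          (\<Sum>Y\<in>upsets l S. ?f l Y * tubing_sum t l (S - Y)) + (\<Sum>B\<in>Pow N - {{}} - {N}. mid B l S)"
        using sum.remove[OF finN, of "\<lambda>B. mid B l S"] by simp
      moreover have "?f l S = sandwich_sum t W U' l S + s * ((\<Sum>B\<in>Pow N - {{}}.
          low B l S - tubing_sum t l0 (U' \<union> B) * sandwich_sum t W {} l S)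
          + (\<Sum>B\<in>Pow N - {{}}. mid B l S))"
        unfolding rec[OF Q] nil sum.empty
        by (simp only: sum.distrib sum_subtractf sum.neutral_const algebra_simps)
      ultimately show ?thesis
        unfolding r_def by algebra
    qed
    then show ?thesis by (rule expands_fixpoint[OF er s _ her])
  qed
qed

text \<open>
  If there is nothing above \<open>S\<close>, then the poset is replaced by its dual, in which \<open>W\<close> lies above; the
  expansion carries over since chain sums are self-dual.
\<close>

lemma expands_sandwich:
  fixes l0 :: "'v \<Rightarrow> int"
  assumes "finite W" "finite U" and t: "t > 0" and "\<And>x y. x \<in> W \<Longrightarrow> y \<in> U \<Longrightarrow> l0 x < l0 y"
  shows "expands t (fits l0 W U) (sandwich_sum t W U)"
  using assms(1,2,4)
proof (induction "card W + card U" arbitrary: W U l0 rule: less_induct)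
  case less
  have IH: "expands t (fits l1 W' U') (sandwich_sum t W' U')"
    if "finite W'" "finite U'" "card W' + card U' < card W + card U"
      "\<And>x y. x \<in> W' \<Longrightarrow> y \<in> U' \<Longrightarrow> l1 x < l1 y" for W' U' :: "'v set" and l1
    using less.hyps[of W' U' l1] that by blast
  show ?case
  proof (cases "U = {}")
    case False
    show ?thesis
    proof (rule expands_sandwich_step[OF less.prems(1,2) t False less.prems(3)])
      fix W' U' assume "W' \<subseteq> W" "U' \<subseteq> U" "card W' + card U' < card W + card U"
      then show "expands t (fits l0 W' U') (sandwich_sum t W' U')"
        using less.prems by (intro IH) (auto intro: finite_subset)
    qed
  next
    case U: True
    show ?thesis
    proof (cases "W = {}")
      case True
      have "tubing_sum t l S = chain_series t l (1 + fps_X) S" if "finite S" for l and S :: "'v set"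
        using chain_series_tubing_sum[OF that] by simp
      then show ?thesis
        unfolding expands_def U True fits_def by (intro exI[of _ "1 + fps_X"]) simp
    next
      case False
      have "expands t (fits (\<lambda>x. - l0 x) {} W) (sandwich_sum t {} W)"
      proof (rule expands_sandwich_step[OF _ less.prems(1) t False])
        fix W' U' :: "'v set" assume "W' \<subseteq> {}" "U' \<subseteq> W" "card W' + card U' < card {} + card W"
        then show "expands t (fits (\<lambda>x. - l0 x) W' U') (sandwich_sum t W' U')"
          using less.prems by (intro IH) (auto intro: finite_subset simp: U)
      qed auto
      then obtain c where c: "\<And>l S. fits (\<lambda>x. - l0 x) {} W l S \<Longrightarrow>
          sandwich_sum t {} W l S = chain_series t l c S"
        unfolding expands_def by blast
      have "sandwich_sum t W U l S = chain_series t l c S" if "fits l0 W U l S" for l S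
      proof -
        have "sandwich_sum t W U l S = sandwich_sum t {} W (\<lambda>x. - l x) S"
          unfolding U by (simp add: Un_commute, rule tubing_sum_dual) auto
        also have "\<dots> = chain_series t (\<lambda>x. - l x) c S"
          by (rule c) (use that in \<open>auto simp: fits_def\<close>)
        also have "\<dots> = chain_series t l c S"
          by (rule chain_series_dual) (use that in \<open>auto simp: fits_def\<close>)
        finally show ?thesis .
      qed
      then show ?thesis unfolding expands_def by blast
    qed
  qed
qed

text \<open>
  Reversing the order of the levels inside the middle part does not change the chain sums of this
  part, hence not the tubing sum of the whole.
\<close>

lemma tubing_sum_interval_reversal:
  fixes l l' :: "'v \<Rightarrow> int"
  assumes "finite W" "finite S" "finite U" "t > 0"
    and WS: "\<And>x y. x \<in> W \<Longrightarrow> y \<in> S \<Longrightarrow> l x < l y \<and> l' x < l' y"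
    and SU: "\<And>x y. x \<in> S \<Longrightarrow> y \<in> U \<Longrightarrow> l x < l y \<and> l' x < l' y"
    and WU: "\<And>x y. x \<in> W \<Longrightarrow> y \<in> U \<Longrightarrow> l x < l y"
    and eq: "\<And>x. x \<in> W \<union> U \<Longrightarrow> l' x = l x"
    and rev: "\<And>x y. x \<in> S \<Longrightarrow> y \<in> S \<Longrightarrow> l x < l y \<longleftrightarrow> l' y < l' x"
  shows "tubing_sum t l' (W \<union> S \<union> U) = tubing_sum t l (W \<union> S \<union> U)"
proof -
  obtain c where c: "\<And>k. fits l W U k S \<Longrightarrow> sandwich_sum t W U k S = chain_series t k c S"
    using expands_sandwich[OF assms(1,3,4), of l] WU unfolding expands_def by blast
  have "fits l W U l S" "fits l W U l' S"
    using assms unfolding fits_def by blast+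
  then show ?thesis using c chain_series_dual[OF assms(2), of l l' t c] rev by simp
qed

section \<open>Permuting the levels\<close>

definition flip :: "int \<Rightarrow> int \<Rightarrow> int \<Rightarrow> int" where
  "flip p q i = (if p \<le> i \<and> i \<le> q then p + q - i else i)"

lemma tubing_sum_flip:
  fixes l :: "'v \<Rightarrow> int"
  assumes "finite V" "t > 0"
  shows "tubing_sum t (\<lambda>x. flip p q (l x)) V = tubing_sum t l V"
proof -
  let ?W = "{x \<in> V. l x < p}" and ?S = "{x \<in> V. p \<le> l x \<and> l x \<le> q}" and ?U = "{x \<in> V. p \<le> l x \<and> q < l x}"
  have V: "V = ?W \<union> ?S \<union> ?U" by auto
  have "tubing_sum t (\<lambda>x. flip p q (l x)) (?W \<union> ?S \<union> ?U) = tubing_sum t l (?W \<union> ?S \<union> ?U)"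
    by (rule tubing_sum_interval_reversal) (use assms in \<open>auto simp: flip_def\<close>)
  then show ?thesis using V by simp
qed

text \<open>
  Reversing an interval and then its interior only exchanges the two end points.
\<close>

lemma transpose_eq_flip:
  assumes "p < q"
  shows "Transposition.transpose p q i = flip p q (flip (p + 1) (q - 1) i)"
  using assms by (auto simp: flip_def Transposition.transpose_def)

lemma tubing_sum_transpose:
  fixes l :: "'v \<Rightarrow> int"
  assumes "finite V" "t > 0"
  shows "tubing_sum t (\<lambda>x. Transposition.transpose p q (l x)) V = tubing_sum t l V"
proof -
  have less: "tubing_sum t (\<lambda>x. Transposition.transpose p q (l x)) V = tubing_sum t l V" if "p < q" for p q
    unfolding transpose_eq_flip[OF that] tubing_sum_flip[OF assms, of _ _ "\<lambda>x. flip _ _ (l x)"]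
    by (rule tubing_sum_flip[OF assms])
  consider "p < q" | "p = q" | "q < p" by linarith
  then show ?thesis
  proof cases
    case 3
    then show ?thesis using less[of q p] by (simp add: transpose_commute)
  qed (use less in auto)
qed

lemma tubing_sum_permute_levels:
  fixes h :: "'v \<Rightarrow> nat"
  assumes "finite V" "t > 0" "\<rho> permutes {1..n}"
  shows "tubing_sum t (\<lambda>x. int (\<rho> (h x))) V = tubing_sum t (\<lambda>x. int (h x)) V"
  using assms(3) finite_atLeastAtMost
proof (induction rule: permutes_induct)
  case id
  then show ?case by simp
next
  case (swap a b p)
  have "int (Transposition.transpose a b i) = Transposition.transpose (int a) (int b) (int i)" for i
    by (simp add: Transposition.transpose_def)
  then show ?case
    using swap.IH tubing_sum_transpose[OF assms(1,2), of "int a" "int b" "\<lambda>x. int (p (h x))"] by simp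
qed

text \<open>
  Two polynomials that agree at all positive reals have the same coefficients.
\<close>

lemma card_eq_if_weights_eq:
  fixes A :: "'a set" and B :: "'b set" and f :: "'a \<Rightarrow> nat" and g :: "'b \<Rightarrow> nat"
  assumes fin: "finite A" "finite B"
    and eq: "\<And>t::real. t > 0 \<Longrightarrow> (\<Sum>x\<in>A. t ^ f x) = (\<Sum>x\<in>B. t ^ g x)"
  shows "card {x \<in> A. f x = k} = card {x \<in> B. g x = k}"
proof -
  have coeff: "coeff (\<Sum>x\<in>X. monom (1::real) (h x)) k = card {x \<in> X. h x = k}"
    if "finite X" for X :: "'c set" and h
  proof -
    have "coeff (\<Sum>x\<in>X. monom (1::real) (h x)) k = (\<Sum>x\<in>X. if h x = k then 1 else 0)"
      by (simp add: coeff_sum)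
    also have "\<dots> = card (X \<inter> {x. h x = k})" using that by (simp add: sum.If_cases)
    finally show ?thesis by (simp add: Int_def)
  qed
  define P where "P = (\<Sum>x\<in>A. monom (1::real) (f x)) - (\<Sum>x\<in>B. monom 1 (g x))"
  have "poly P t = 0" if "t > 0" for t
    using eq[OF that] by (simp add: P_def poly_sum poly_monom)
  then have "{0<..} \<subseteq> {t. poly P t = 0}" by auto
  then have "infinite {t. poly P t = 0}" using infinite_Ioi finite_subset by blast
  then have "P = 0" using poly_roots_finite by blast
  then have "coeff (\<Sum>x\<in>A. monom (1::real) (f x)) k = coeff (\<Sum>x\<in>B. monom (1::real) (g x)) k"
    by (simp add: P_def)
  then show ?thesis using coeff[OF fin(1), of f] coeff[OF fin(2), of g] by simp
qed

section \<open>Complete graded posets\<close>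

abbreviation level :: "nat \<times> nat \<Rightarrow> int" where
  "level x \<equiv> int (fst x)"

lemma complete_graded_poset_iff:
  assumes "x \<in> complete_graded_set n a" "y \<in> complete_graded_set n a"
  shows "(x, y) \<in> complete_graded_poset n a \<longleftrightarrow> x = y \<or> level x < level y"
  using assms by (auto simp: complete_graded_poset_def)

lemma order_convex_iff:
  assumes "M \<subseteq> complete_graded_set n a"
  shows "order_convex (complete_graded_poset n a) M \<longleftrightarrow>
    (\<forall>x\<in>M. \<forall>y\<in>complete_graded_set n a. \<forall>z\<in>M. level x < level y \<and> level y < level z \<longrightarrow> y \<in> M)"
proof -
  have "((x, y) \<in> complete_graded_poset n a \<and> (y, z) \<in> complete_graded_poset n a \<longrightarrow> y \<in> M) \<longleftrightarrow>
      (level x < level y \<and> level y < level z \<longrightarrow> y \<in> M)"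
    if "x \<in> M" "y \<in> complete_graded_set n a" "z \<in> M" for x y z
    using that assms complete_graded_poset_iff[of x n a y] complete_graded_poset_iff[of y n a z] by blast
  then show ?thesis unfolding order_convex_def Field_complete_graded_poset by blast
qed

text \<open>
  A set inside one level has no Hasse edges. If a convex set meets two levels, then elements of
  different levels are joined by a path with one step per level, for which the intermediate elements
  come from convexity and from the levels being nonempty; elements of the same level are joined
  through an element of another level.
\<close>

lemma hasse_connected_iff_two_levels:
  assumes a: "\<forall>i\<in>{1..n}. 1 \<le> a i" and M: "M \<subseteq> complete_graded_set n a" "2 \<le> card M"
    and conv: "order_convex (complete_graded_poset n a) M"
  shows "hasse_connected (complete_graded_poset n a) M \<longleftrightarrow> (\<exists>x\<in>M. \<exists>y\<in>M. level x < level y)"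
proof
  let ?P = "complete_graded_poset n a"
  assume con: "hasse_connected ?P M"
  show "\<exists>x\<in>M. \<exists>y\<in>M. level x < level y"
  proof (rule ccontr)
    assume neg: "\<not> (\<exists>x\<in>M. \<exists>y\<in>M. level x < level y)"
    have "hasse_edges ?P \<inter> M \<times> M = {}"
      using neg by (auto simp: hasse_edges_def covers_def complete_graded_poset_def)
    then have "x = y" if "x \<in> M" "y \<in> M" for x y
      using con that unfolding hasse_connected_def by auto
    then have "card M \<le> 1" by (metis card_le_Suc0_iff_eq card.infinite One_nat_def zero_le_one)
    then show False using M by simp
  qed
next
  let ?P = "complete_graded_poset n a" and ?E = "hasse_edges (complete_graded_poset n a) \<inter> M \<times> M"
  assume "\<exists>x\<in>M. \<exists>y\<in>M. level x < level y"
  then obtain u v where uv: "u \<in> M" "v \<in> M" "fst u < fst v" by auto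
  have edge: "(x, y) \<in> ?E \<and> (y, x) \<in> ?E" if "x \<in> M" "y \<in> M" "fst y = Suc (fst x)" for x y
    using that M(1) by (auto simp: hasse_edges_def covers_def complete_graded_poset_def)
  have sym: "sym (?E\<^sup>*)"
    by (intro sym_rtrancl) (auto simp: sym_def hasse_edges_def)
  have between: "z \<in> M" if "x \<in> M" "y \<in> M" "z \<in> complete_graded_set n a" "fst x < fst z" "fst z < fst y" for x y z
    using conv that unfolding order_convex_iff[OF M(1)] of_nat_less_iff by blast
  have up: "(x, y) \<in> ?E\<^sup>*" if "x \<in> M" "y \<in> M" "fst x < fst y" for x y
    using that
  proof (induction "fst y - fst x" arbitrary: x)
    case 0
    then show ?case by simp
  next
    case (Suc d)
    show ?case
    proof (cases "fst y = Suc (fst x)")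
      case True
      then show ?thesis using edge Suc.prems by blast
    next
      case False
      define z where "z = (Suc (fst x), 1::nat)"
      have "fst y \<le> n" "1 \<le> fst x" using Suc.prems M by (auto simp: complete_graded_set_def)
      then have "z \<in> complete_graded_set n a"
        using a Suc.prems by (auto simp: z_def complete_graded_set_def)
      then have z: "z \<in> M" using between[of x y z] Suc.prems False by (simp add: z_def)
      then have "(z, y) \<in> ?E\<^sup>*" using Suc False by (intro Suc.hyps) (auto simp: z_def)
      moreover have "(x, z) \<in> ?E" using edge[of x z] z Suc.prems by (simp add: z_def)
      ultimately show ?thesis by (meson converse_rtrancl_into_rtrancl)
    qed
  qed
  have comp: "(x, y) \<in> ?E\<^sup>*" if "x \<in> M" "y \<in> M" "fst x \<noteq> fst y" for x y
    using that up[of x y] up[of y x] sym by (meson linorder_neqE_nat symD)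
  have "(x, y) \<in> ?E\<^sup>*" if x: "x \<in> M" and y: "y \<in> M" for x y
  proof (cases "fst x = fst y")
    case True
    have "\<exists>w\<in>M. fst w \<noteq> fst x" using uv by (metis less_irrefl)
    then obtain w where "w \<in> M" "fst w \<noteq> fst x" by blast
    then show ?thesis using comp[of x w] comp[of w y] x y True by (metis rtrancl_trans)
  qed (use comp x y in blast)
  then show "hasse_connected ?P M" unfolding hasse_connected_def by blast
qed

lemma proper_tube_iff:
  assumes a: "\<forall>i\<in>{1..n}. 1 \<le> a i"
  shows "proper_tube (complete_graded_poset n a) M \<longleftrightarrow>
    tube level (complete_graded_set n a) M \<and> M \<noteq> complete_graded_set n a"
proof (cases "M \<subseteq> complete_graded_set n a")
  case True
  let ?V = "complete_graded_set n a"
  have fin: "finite M" using True finite_complete_graded_set by (rule finite_subset)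
  have "2 \<le> card M" if "x \<in> M" "y \<in> M" "level x < level y" for x y
  proof -
    have "x \<noteq> y" using that by auto
    then show ?thesis using card_mono[OF fin, of "{x, y}"] that by simp
  qed
  then show ?thesis
    using True order_convex_iff[OF True] hasse_connected_iff_two_levels[OF a True]
    unfolding proper_tube_def tube_def Field_complete_graded_poset by blast
next
  case False
  then show ?thesis by (auto simp: proper_tube_def tube_def Field_complete_graded_poset)
qed

text \<open>
  Excluding 2-cycles is enough: along an edge of the digraph the first tube lies before the second, and
  since the first meets two levels, the lowest level of a tube strictly increases.
\<close>

lemma acyclic_tubing_digraph_iff:
  assumes "\<And>A. A \<in> T \<Longrightarrow> tube level (complete_graded_set n a) A"
  shows "acyclic (tubing_digraph (complete_graded_poset n a) T) \<longleftrightarrow>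
    (\<forall>A\<in>T. \<forall>B\<in>T. A \<inter> B = {} \<longrightarrow> before level A B \<or> before level B A)"
proof
  let ?D = "tubing_digraph (complete_graded_poset n a) T"
  have edge: "(A, B) \<in> ?D \<longleftrightarrow> A \<in> T \<and> B \<in> T \<and> A \<inter> B = {} \<and> (\<exists>x\<in>A. \<exists>y\<in>B. level x < level y)" for A B
  proof (cases "A \<in> T \<and> B \<in> T")
    case True
    then have "A \<subseteq> complete_graded_set n a" "B \<subseteq> complete_graded_set n a"
      using assms by (simp_all add: tube_def)
    then have "(x, y) \<in> complete_graded_poset n a \<and> x \<noteq> y \<longleftrightarrow> level x < level y"
      if "x \<in> A" "y \<in> B" for x y
      using that complete_graded_poset_iff[of x n a y] by auto
    then show ?thesis using True unfolding tubing_digraph_def by blast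
  qed (auto simp: tubing_digraph_def)
  {
    assume ac: "acyclic ?D"
    show "\<forall>A\<in>T. \<forall>B\<in>T. A \<inter> B = {} \<longrightarrow> before level A B \<or> before level B A"
    proof (intro ballI impI)
      fix A B assume AB: "A \<in> T" "B \<in> T" "A \<inter> B = {}"
      have "\<not> ((A, B) \<in> ?D \<and> (B, A) \<in> ?D)"
        using ac unfolding acyclic_def by (meson trancl.r_into_trancl trancl.trancl_into_trancl)
      then have "\<not> (\<exists>x\<in>A. \<exists>y\<in>B. level x < level y) \<or> \<not> (\<exists>x\<in>B. \<exists>y\<in>A. level x < level y)"
        using AB by (auto simp: edge)
      then show "before level A B \<or> before level B A"
        using AB(3) unfolding before_def by (metis inf_commute linorder_not_less)
    qed
  next
    assume b: "\<forall>A\<in>T. \<forall>B\<in>T. A \<inter> B = {} \<longrightarrow> before level A B \<or> before level B A"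
    have step: "Min (level ` A) < Min (level ` B)" if e: "(A, B) \<in> ?D" for A B
    proof -
      have T: "A \<in> T" "B \<in> T" "A \<inter> B = {}" "\<exists>x\<in>A. \<exists>y\<in>B. level x < level y"
        using e by (simp_all add: edge)
      have fin: "finite A" "finite B" and ne: "B \<noteq> {}"
        using assms[OF T(1)] assms[OF T(2)] finite_complete_graded_set[of n a]
        by (auto simp: tube_def intro: finite_subset)
      have "\<not> before level B A" using T(4) unfolding before_def by (meson linorder_not_less)
      then have bef: "before level A B" using b T by blast
      obtain x y where xy: "x \<in> A" "y \<in> A" "level x < level y" using assms[OF T(1)] by (auto simp: tube_def)
      have "Min (level ` B) \<in> level ` B" using fin ne by simp
      then obtain z where z: "z \<in> B" "Min (level ` B) = level z" by auto
      have "Min (level ` A) \<le> level x" using fin xy by simp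
      moreover have "level y \<le> level z" using bef xy z by (auto simp: before_def)
      ultimately show ?thesis using xy z by simp
    qed
    have "Min (level ` A) < Min (level ` B)" if "(A, B) \<in> ?D\<^sup>+" for A B
      using that by (induction rule: trancl_induct) (use step in \<open>blast intro: less_trans\<close>)+
    then show "acyclic ?D" unfolding acyclic_def by blast
  }
qed

lemma proper_tubing_iff:
  assumes a: "\<forall>i\<in>{1..n}. 1 \<le> a i"
  shows "proper_tubing (complete_graded_poset n a) T \<longleftrightarrow>
    T \<in> tubings level (complete_graded_set n a) \<and> complete_graded_set n a \<notin> T"
proof (cases "\<forall>A\<in>T. tube level (complete_graded_set n a) A")
  case True
  have cpt: "compatible level A B \<longleftrightarrow> (A \<subseteq> B \<or> B \<subseteq> A \<or> A \<inter> B = {}) \<and>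
      (A \<inter> B = {} \<longrightarrow> before level A B \<or> before level B A)" if "A \<in> T" "B \<in> T" for A B
  proof -
    have "A \<noteq> {}" "B \<noteq> {}" using True that by (auto simp: tube_def)
    moreover have "before level A B \<Longrightarrow> A \<inter> B = {}" "before level B A \<Longrightarrow> A \<inter> B = {}"
      by (auto simp: before_def)
    ultimately show ?thesis unfolding compatible_def by blast
  qed
  have tub: "T \<in> tubings level (complete_graded_set n a) \<longleftrightarrow>
      (\<forall>A\<in>T. \<forall>B\<in>T. A \<subseteq> B \<or> B \<subseteq> A \<or> A \<inter> B = {}) \<and>
      (\<forall>A\<in>T. \<forall>B\<in>T. A \<inter> B = {} \<longrightarrow> before level A B \<or> before level B A)"
    unfolding ball_conj_distrib[symmetric] using True by (simp add: tubings_def cpt cong: ball_cong)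
  have proper: "(\<forall>A\<in>T. proper_tube (complete_graded_poset n a) A) \<longleftrightarrow> complete_graded_set n a \<notin> T"
    using True unfolding proper_tube_iff[OF a] by blast
  have ac: "acyclic (tubing_digraph (complete_graded_poset n a) T) \<longleftrightarrow>
      (\<forall>A\<in>T. \<forall>B\<in>T. A \<inter> B = {} \<longrightarrow> before level A B \<or> before level B A)"
    using True by (intro acyclic_tubing_digraph_iff) blast
  show ?thesis
    unfolding proper_tubing_def proper ac tub by (simp only: conj_ac)
next
  case False
  then show ?thesis by (auto simp: proper_tubing_def proper_tube_iff[OF a] tubings_def)
qed

text \<open>
  Permuting the sizes of the levels amounts, up to isomorphism, to keeping the set and permuting its
  levels by the inverse permutation.
\<close>

lemma proper_tubing_sum_permute:
  fixes a :: "nat \<Rightarrow> nat"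
  assumes n: "2 \<le> n" and a: "\<forall>i\<in>{1..n}. 1 \<le> a i" and \<pi>: "\<pi> permutes {1..n}" and t: "t > 0"
  shows "proper_sum t level (complete_graded_set n (\<lambda>i. a (\<pi> i))) = proper_sum t level (complete_graded_set n a)"
proof -
  have sum: "tubing_sum t level (complete_graded_set n b) = (1 + t) * proper_sum t level (complete_graded_set n b)"
    if "\<forall>i\<in>{1..n}. 1 \<le> b i" for b
  proof (rule tubing_sum_proper_sum[OF finite_complete_graded_set])
    show "(1, 1) \<in> complete_graded_set n b" "(2, 1) \<in> complete_graded_set n b"
      using that n by (auto simp: complete_graded_set_def)
  qed simp
  let ?V = "complete_graded_set n a" and ?V' = "complete_graded_set n (\<lambda>i. a (\<pi> i))"
  define h where "h = (\<lambda>x::nat \<times> nat. (\<pi> (fst x), snd x))"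
  have range: "\<pi> i \<in> {1..n} \<longleftrightarrow> i \<in> {1..n}" for i by (rule permutes_in_image[OF \<pi>])
  have inj: "inj_on h ?V'"
    using permutes_inj[OF \<pi>] by (auto simp: h_def inj_on_def inj_def)
  have img: "h ` ?V' = ?V"
  proof (intro subset_antisym subsetI)
    fix x assume "x \<in> h ` ?V'"
    then obtain y where y: "x = h y" "y \<in> ?V'" by blast
    then show "x \<in> ?V" using range[of "fst y"] by (simp add: h_def complete_graded_set_def split_beta)
  next
    fix x assume x: "x \<in> ?V"
    have inv: "\<pi> (inv \<pi> (fst x)) = fst x" by (rule permutes_inverses(1)[OF \<pi>])
    have "(inv \<pi> (fst x), snd x) \<in> ?V'"
      using x range[of "inv \<pi> (fst x)"] by (auto simp: complete_graded_set_def inv)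
    then show "x \<in> h ` ?V'" by (rule image_eqI[rotated]) (simp add: h_def inv)
  qed
  have "tubing_sum t (\<lambda>x. int (inv \<pi> (fst x))) ?V = tubing_sum t level ?V"
    by (rule tubing_sum_permute_levels[OF finite_complete_graded_set t permutes_inv[OF \<pi>]])
  moreover have "tubing_sum t (\<lambda>x. int (inv \<pi> (fst x))) ?V = tubing_sum t level ?V'"
    using tubing_sum_image[OF inj, of t "\<lambda>x. int (inv \<pi> (fst x))"]
    unfolding img by (simp add: h_def o_def permutes_inverses(2)[OF \<pi>])
  moreover have "\<forall>i\<in>{1..n}. 1 \<le> a (\<pi> i)" using a range by blast
  ultimately show ?thesis using sum[of a] sum[of "\<lambda>i. a (\<pi> i)"] a t by simp
qed

lemma card_proper_tubings_permute:
  fixes a :: "nat \<Rightarrow> nat"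
  assumes "2 \<le> n" and a: "\<forall>i\<in>{1..n}. 1 \<le> a i" and \<pi>: "\<pi> permutes {1..n}"
  shows "card {T. proper_tubing (complete_graded_poset n (\<lambda>i. a (\<pi> i))) T \<and> card T = k} =
    card {T. proper_tubing (complete_graded_poset n a) T \<and> card T = k}"
proof -
  have a': "\<forall>i\<in>{1..n}. 1 \<le> a (\<pi> i)"
    using a permutes_in_image[OF \<pi>] by blast
  let ?T = "\<lambda>b. {T \<in> tubings level (complete_graded_set n b). complete_graded_set n b \<notin> T}"
  have "card {T \<in> ?T (\<lambda>i. a (\<pi> i)). card T = k} = card {T \<in> ?T a. card T = k}"
  proof (rule card_eq_if_weights_eq)
    show "finite (?T b)" for b using finite_tubings[OF finite_complete_graded_set, of level n b] by simp
    then show "finite (?T b)" for b .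
    show "(\<Sum>T\<in>?T (\<lambda>i. a (\<pi> i)). t ^ card T) = (\<Sum>T\<in>?T a. t ^ card T)" if "t > 0" for t :: real
      using proper_tubing_sum_permute[OF assms that] unfolding proper_sum_def .
  qed
  then show ?thesis unfolding proper_tubing_iff[OF a] proper_tubing_iff[OF a'] by simp
qed

lemma card_complete_graded_set: "card (complete_graded_set n a) = (\<Sum>i\<in>{1..n}. a i)"
proof -
  have "complete_graded_set n a = (SIGMA i:{1..n}. {1..a i})" by (auto simp: complete_graded_set_def)
  then show ?thesis by simp
qed

lemma card_complete_graded_set_permute:
  assumes "\<pi> permutes {1..n}"
  shows "card (complete_graded_set n (\<lambda>i. a (\<pi> i))) = card (complete_graded_set n a)"
  unfolding card_complete_graded_set using sum.permute[OF assms, of a] by (simp add: o_def)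

section \<open>Faces of a realization\<close>

text \<open>
  The dimension of a face \<open>F\<close> is determined by the order isomorphism. Descending from \<open>R\<close> to \<open>F\<close> through
  facets of facets lowers the dimension by \<open>1\<close> and adds at least one tube in each step, so the number
  of tubes is at least the codimension. Conversely, a subset of a proper tubing is a proper
  tubing, so removing the tubes one by one gives a strictly increasing sequence of faces from \<open>F\<close> to
  \<open>R\<close>, and the number of tubes is at most the codimension.
\<close>

lemma f_polynomial_eq_tubing_f_polynomial:
  fixes R :: "'a::euclidean_space set"
  assumes "poset_associahedron r R"
  shows "f_polynomial R = tubing_f_polynomial r"
proof -
  define d where "d = card (Field r) - 2"
  have R: "polytope R" "R \<noteq> {}" and fr: "finite (Field r)" and dim: "aff_dim R = int d"
    using assms unfolding poset_associahedron_def simple_polytope_def finite_connected_poset_def d_def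
    by (auto simp: of_nat_diff)
  obtain \<phi> where bij: "bij_betw \<phi> {F. F face_of R \<and> F \<noteq> {}} {T. proper_tubing r T}"
    and ord': "\<forall>F G. F face_of R \<and> F \<noteq> {} \<and> G face_of R \<and> G \<noteq> {} \<longrightarrow> (F \<subseteq> G \<longleftrightarrow> \<phi> G \<subseteq> \<phi> F)"
    using assms unfolding poset_associahedron_def by (elim conjE exE) (rule that; assumption)
  have ord: "F \<subseteq> G \<longleftrightarrow> \<phi> G \<subseteq> \<phi> F"
    if "F face_of R" "F \<noteq> {}" "G face_of R" "G \<noteq> {}" for F G
    using ord' that by simp
  have fin: "finite T" if "proper_tubing r T" for T
    by (rule finite_subset[of _ "Pow (Field r)"])
      (use that fr in \<open>auto simp: proper_tubing_def proper_tube_def\<close>)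
  have sub: "proper_tubing r T'" if "proper_tubing r T" "T' \<subseteq> T" for T T'
  proof -
    have "tubing_digraph r T' \<subseteq> tubing_digraph r T" using that(2) by (auto simp: tubing_digraph_def)
    then show ?thesis using that unfolding proper_tubing_def by (meson acyclic_subset subsetD)
  qed
  have tub: "proper_tubing r (\<phi> F)" if "F face_of R" "F \<noteq> {}" for F
    using bij that by (auto simp: bij_betw_def)
  have realized: "\<exists>F. F face_of R \<and> F \<noteq> {} \<and> \<phi> F = T" if "proper_tubing r T" for T
  proof -
    have "T \<in> \<phi> ` {F. F face_of R \<and> F \<noteq> {}}"
      unfolding bij_betw_imp_surj_on[OF bij] using that by simp
    then show ?thesis by blast
  qed
  have strict: "\<phi> G \<subset> \<phi> F" if "F face_of R" "F \<noteq> {}" "G face_of R" "G \<noteq> {}" "F \<subset> G" for F G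
    using ord[of F G] ord[of G F] that by blast
  have top: "\<phi> R = {}"
  proof -
    have "proper_tubing r {}" by (simp add: proper_tubing_def tubing_digraph_def acyclic_def)
    then obtain F where F: "F face_of R" "F \<noteq> {}" "\<phi> F = {}"
      using realized by blast
    then show ?thesis
      using ord[of F R] face_of_imp_subset[OF F(1)] face_of_refl[of R] R by (auto simp: polytope_imp_convex)
  qed
  \<comment> \<open>Stated for a face \<open>G\<close> in place of \<open>R\<close>, so that the induction can pass to a facet.\<close>
  have codim_le: "aff_dim G - aff_dim F \<le> int (card (\<phi> F)) - int (card (\<phi> G))"
    if "F face_of G" "F \<noteq> {}" "G face_of R" for F G
    using that
  proof (induction "nat (aff_dim G)" arbitrary: G rule: less_induct)
    case less
    have FR: "F face_of R" using less.prems face_of_trans by blast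
    show ?case
    proof (cases "F = G")
      case False
      have "polytope G" using face_of_polytope_polytope[OF R(1) less.prems(3)] .
      then obtain H where H: "H facet_of G" "F \<subseteq> H"
        using face_of_polyhedron_subset_facet[of G F] less.prems False polytope_imp_polyhedron by blast
      have HG: "H face_of G" "H \<noteq> {}" "aff_dim H = aff_dim G - 1" using H by (auto simp: facet_of_def)
      have HR: "H face_of R" using HG(1) less.prems(3) face_of_trans by blast
      have "aff_dim H \<ge> 0" using HG(2) by (simp flip: not_less)
      have FH: "F face_of H" using face_of_subset[OF less.prems(1) H(2)] HG(1) face_of_imp_subset by blast
      have "aff_dim H - aff_dim F \<le> int (card (\<phi> F)) - int (card (\<phi> H))"
        using \<open>aff_dim H \<ge> 0\<close> HG(3) by (intro less.hyps FH less.prems(2) HR) simp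
      moreover have "H \<subset> G" using HG(3) face_of_imp_subset[OF HG(1)] by auto
      then have "\<phi> G \<subset> \<phi> H" using strict[of H G] HG HR less.prems(3) by blast
      then have "card (\<phi> G) < card (\<phi> H)" using fin[OF tub[OF HR HG(2)]] by (rule psubset_card_mono[rotated])
      ultimately show ?thesis using HG(3) by simp
    qed simp
  qed
  have codim_ge: "int (card (\<phi> F)) \<le> aff_dim R - aff_dim F" if "F face_of R" "F \<noteq> {}" for F
    using that
  proof (induction "card (\<phi> F)" arbitrary: F)
    case 0
    then show ?case using aff_dim_subset[OF face_of_imp_subset[OF 0(2)]] by simp
  next
    case (Suc k)
    then obtain A where A: "A \<in> \<phi> F" by (metis card.empty nat.distinct(1) equals0I)
    have "proper_tubing r (\<phi> F - {A})" using sub[OF tub[OF Suc.prems]] by blast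
    then obtain G where G: "G face_of R" "G \<noteq> {}" "\<phi> G = \<phi> F - {A}"
      using realized by blast
    have "card (\<phi> G) = k"
      using Suc.hyps(2) A G(3) fin[OF tub[OF Suc.prems]] by simp
    then have "int k \<le> aff_dim R - aff_dim G" using Suc.hyps(1)[of G] G by simp
    moreover have "F \<subseteq> G" using ord[of F G] G Suc.prems by blast
    moreover have "F \<noteq> G" using A G(3) by blast
    then have "aff_dim F < aff_dim G"
      using face_of_aff_dim_lt[of G F] face_of_subset[OF Suc.prems(1) \<open>F \<subseteq> G\<close>] G(1)
      by (meson R(1) face_of_imp_convex face_of_imp_subset polytope_imp_convex)
    ultimately show ?case using Suc.hyps(2) by simp
  qed
  have codim: "aff_dim F = int d - int (card (\<phi> F))" if "F face_of R" "F \<noteq> {}" for F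
  proof -
    have "aff_dim R - aff_dim F \<le> int (card (\<phi> F)) - int (card (\<phi> R))"
      using R by (intro codim_le[OF that]) (simp add: face_of_refl polytope_imp_convex)
    then show ?thesis using codim_ge[OF that] by (simp add: top dim)
  qed
  have "card {F. F face_of R \<and> aff_dim F = int i} = card {T. proper_tubing r T \<and> card T = d - i}"
    if i: "i \<le> d" for i
  proof (rule bij_betw_same_card)
    have "bij_betw \<phi> {F \<in> {F. F face_of R \<and> F \<noteq> {}}. aff_dim F = int i}
        {T \<in> {T. proper_tubing r T}. card T = d - i}"
      by (rule bij_betw_Collect[OF bij]) (use codim i in auto)
    moreover have "{F \<in> {F. F face_of R \<and> F \<noteq> {}}. aff_dim F = int i} = {F. F face_of R \<and> aff_dim F = int i}"
      by auto
    ultimately show "bij_betw \<phi> {F. F face_of R \<and> aff_dim F = int i} {T. proper_tubing r T \<and> card T = d - i}"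
      by simp
  qed
  then show ?thesis
    unfolding f_polynomial_def tubing_f_polynomial_def dim d_def[symmetric] by simp
qed

theorem corollary1p3:
  fixes n :: nat and a :: "nat \<Rightarrow> nat" and \<pi> :: "nat \<Rightarrow> nat"
  assumes "2 \<le> n"
    and "\<forall>i\<in>{1..n}. 1 \<le> a i"
    and "\<pi> permutes {1..n}"
  shows "(\<forall>(R :: 'a::euclidean_space set) (R' :: 'b::euclidean_space set).
            poset_associahedron (complete_graded_poset n a) R \<and>
            poset_associahedron (complete_graded_poset n (\<lambda>i. a (\<pi> i))) R' \<longrightarrow>
            f_polynomial R = f_polynomial R') \<and>
         tubing_f_polynomial (complete_graded_poset n a) =
         tubing_f_polynomial (complete_graded_poset n (\<lambda>i. a (\<pi> i)))"
proof -
  have eq: "tubing_f_polynomial (complete_graded_poset n a) =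
      tubing_f_polynomial (complete_graded_poset n (\<lambda>i. a (\<pi> i)))"
    unfolding tubing_f_polynomial_def Field_complete_graded_poset
      card_complete_graded_set_permute[OF assms(3)] card_proper_tubings_permute[OF assms] ..
  then show ?thesis
    using f_polynomial_eq_tubing_f_polynomial by metis
qed

end
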